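(* Let $\lambda_1,\lambda_2>0$, $\sigma>0$, $h>0$, and let $\alpha_1\neq\alpha_2$ be real numbers. Let $\varepsilon=(\varepsilon_t)_{t\ge 0}$ be a continuous-time Markov chain on $\{1,2\}$ with transition intensities $q_{12}=\lambda_1$ (from state 1 to state 2) and $q_{21}=\lambda_2$ (from state 2 to state 1), let $W$ be a standard Brownian motion independent of $\varepsilon$, and let $Z_h=\int_0^h\alpha_{\varepsilon_s}\,ds+\sigma W_h$. Put $a=\frac12(\alpha_1+\alpha_2)$ and $b_1=\frac12(\alpha_1-\alpha_2)$. Then the following hold. (i) The density of $Z_h$ given $\varepsilon_0=1$ is $$g_1(z,h)=e^{-\lambda_1h}\Big[\phi_{\sigma\sqrt h}(z-h(b_1+a))+\frac1{|b_1|}\int_{h(a-|b_1|)}^{h(a+|b_1|)}\phi_{\sigma\sqrt h}(z-x)\,\tilde p_h\Big(\frac{x-ah}{b_1}\Big)dx\Big],\quad z\in\mathbb{R},$$ with, for $x\in[-h,h]$, $$\tilde p_h(x)=\frac{\lambda_1}2\exp\Big(\frac{\lambda_1-\lambda_2}2(h-x)\Big)\Big[B_0\big(\sqrt{\lambda_1\lambda_2(h^2-x^2)}\big)+\Big(\frac{(h+x)\lambda_2}{(h-x)\lambda_1}\Big)^{1/2}B_1\big(\sqrt{\lambda_1\lambda_2(h^2-x^2)}\big)\Big].$$ (ii) The density of $Z_h$ given $\varepsilon_0=\varepsilon_h=1$ is $$g_{11}(z,h)=\frac{\lambda_1+\lambda_2}{\lambda_2e^{\lambda_1h}+\lambda_1e^{-\lambda_2h}}\Big[\phi_{\sigma\sqrt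 h}(z-h(b_1+a))+\frac1{|b_1|}\int_{h(a-|b_1|)}^{h(a+|b_1|)}\phi_{\sigma\sqrt h}(z-x)\,\tilde q_{h,+,1}\Big(\frac{x-ah}{b_1}\Big)dx\Big],\quad z\in\mathbb{R},$$ with, for $x\in[-h,h]$, $$\tilde q_{h,+,1}(x)=\frac{\lambda_1}2\exp\Big(\frac{\lambda_1-\lambda_2}2(h-x)\Big)\Big(\frac{(h+x)\lambda_2}{(h-x)\lambda_1}\Big)^{1/2}B_1\big(\sqrt{\lambda_1\lambda_2(h^2-x^2)}\big).$$ (iii) The density of $Z_h$ given $\varepsilon_0=1$, $\varepsilon_h=2$ is $$g_{12}(z,h)=\frac{\lambda_1+\lambda_2}{e^{\lambda_1h}-e^{-\lambda_2h}}\cdot\frac1{|b_1|}\int_{h(a-|b_1|)}^{h(a+|b_1|)}\phi_{\sigma\sqrt h}(z-x)\,\tilde q_{h,-,1}\Big(\frac{x-ah}{b_1}\Big)dx,\quad z\in\mathbb{R},$$ with, for $x\in[-h,h]$, $$\tilde q_{h,-,1}(x)=\frac12\exp\Big(\frac{\lambda_1-\lambda_2}2(h-x)\Big)B_0\big(\sqrt{\lambda_1\lambda_2(h^2-x^2)}\big).$$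
   Context: The functions $B_0,B_1$ are the modified Bessel functions $$B_0(z)=\sum_{k=0}^\infty\frac{(z^2/4)^k}{(k!)^2},\qquad B_1(z)=\frac z2\sum_{k=0}^\infty\frac{(z^2/4)^k}{k!\,(k+1)!},\qquad z\ge0.$$ For $s>0$, $\phi_s(x)=\frac1{\sqrt{2\pi}\,s}e^{-x^2/(2s^2)}$, $x\in\mathbb{R}$, is the density of the centred normal distribution with standard deviation $s$. The intensity matrix is $Q=\begin{pmatrix}-\lambda_1&\lambda_1\\ \lambda_2&-\lambda_2\end{pmatrix}$, with transition probabilities $\mathbb{P}(\varepsilon_{t+h}=j\mid\varepsilon_t=i)=(e^{Qh})_{i,j}$. Conditioning on $\varepsilon_0=1$ means working under the law of $(\varepsilon,W)$ with the chain started in state $1$. Densities are with respect to Lebesgue measure: $g_1(z,h)=\mathbb{P}(Z_h\in dz\mid\varepsilon_0=1)/dz$ and $g_{1j}(z,h)=\mathbb{P}(Z_h\in dz\mid\varepsilon_0=1,\varepsilon_h=j)/dz$. The functions $\tilde p_h,\tilde q_{h,\pm,1}$ enter only under integrals, so their values at the endpoints $x=\pm h$ are immaterial. *)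

theory Defs
  imports "HOL-Probability.Probability"
begin

definition bessel_B0 :: "real \<Rightarrow> real" where
  "bessel_B0 z = (\<Sum>k. (z\<^sup>2 / 4) ^ k / (fact k)\<^sup>2)"

definition bessel_B1 :: "real \<Rightarrow> real" where
  "bessel_B1 z = z / 2 * (\<Sum>k. (z\<^sup>2 / 4) ^ k / (fact k * fact (k + 1)))"

text \<open>
  The three functions below are meant for arguments \<open>x\<close> in \<open>[-h, h]\<close>. At \<open>x = h\<close> the
  convention \<open>r / 0 = 0\<close> applies; they are only used under integrals, where this is irrelevant.
\<close>

definition p_tilde :: "real \<Rightarrow> real \<Rightarrow> real \<Rightarrow> real \<Rightarrow> real" where
  "p_tilde l1 l2 h x = l1 / 2 * exp ((l1 - l2) / 2 * (h - x)) *
     (bessel_B0 (sqrt (l1 * l2 * (h\<^sup>2 - x\<^sup>2))) +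
      sqrt (((h + x) * l2) / ((h - x) * l1)) * bessel_B1 (sqrt (l1 * l2 * (h\<^sup>2 - x\<^sup>2))))"

definition q_tilde_plus :: "real \<Rightarrow> real \<Rightarrow> real \<Rightarrow> real \<Rightarrow> real" where
  "q_tilde_plus l1 l2 h x = l1 / 2 * exp ((l1 - l2) / 2 * (h - x)) *
     sqrt (((h + x) * l2) / ((h - x) * l1)) * bessel_B1 (sqrt (l1 * l2 * (h\<^sup>2 - x\<^sup>2)))"

definition q_tilde_minus :: "real \<Rightarrow> real \<Rightarrow> real \<Rightarrow> real \<Rightarrow> real" where
  "q_tilde_minus l1 l2 h x = 1 / 2 * exp ((l1 - l2) / 2 * (h - x)) *
     bessel_B0 (sqrt (l1 * l2 * (h\<^sup>2 - x\<^sup>2)))"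

text \<open>
  On \<open>real ^ 'n ^ 'n\<close> the operator \<open>*\<close> is componentwise multiplication, so the powers
  in the exponential series are taken with respect to the matrix product \<open>**\<close>.
\<close>

definition matrix_exp :: "real ^ 'n ^ 'n \<Rightarrow> real ^ 'n ^ 'n" where
  "matrix_exp A = (\<Sum>k. (1 / fact k) *\<^sub>R (((**) A ^^ k) (mat 1)))"

text \<open>
  The chain has state space a finite type, so right-continuity of a path means that it is
  constant on some interval to the right of each time. Only the times \<open>t \<ge> 0\<close> matter, and the
  initial law is arbitrary.
\<close>

definition (in prob_space) markov_chain ::
    "real ^ 'n ^ 'n \<Rightarrow> (real \<Rightarrow> 'a \<Rightarrow> 'n) \<Rightarrow> bool" where
  "markov_chain Q X \<longleftrightarrow>
     (\<forall>t\<ge>0. random_variable (count_space UNIV) (X t)) \<and>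
     (\<forall>\<omega>\<in>space M. \<forall>t\<ge>0. \<forall>\<^sub>F s in at_right t. X s \<omega> = X t \<omega>) \<and>
     (\<forall>n (s :: nat \<Rightarrow> real) (x :: nat \<Rightarrow> 'n) t h i j.
        0 \<le> t \<longrightarrow> 0 \<le> h \<longrightarrow> (\<forall>k<n. 0 \<le> s k \<and> s k \<le> t) \<longrightarrow>
        \<P>(\<omega> in M. X t \<omega> = i \<and> (\<forall>k<n. X (s k) \<omega> = x k)) > 0 \<longrightarrow>
        \<P>(\<omega> in M. X (t + h) \<omega> = j \<bar> X t \<omega> = i \<and> (\<forall>k<n. X (s k) \<omega> = x k))
          = matrix_exp (h *\<^sub>R Q) $ i $ j)"

text \<open>The two states are the elements \<open>1\<close> and \<open>2\<close> of the numeral type \<open>2\<close> (where \<open>2 = 0\<close>).\<close>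

definition intensity_matrix :: "real \<Rightarrow> real \<Rightarrow> real ^ 2 ^ 2" where
  "intensity_matrix l1 l2 = vector [vector [- l1, l1], vector [l2, - l2]]"

definition (in prob_space) standard_brownian_motion :: "(real \<Rightarrow> 'a \<Rightarrow> real) \<Rightarrow> bool" where
  "standard_brownian_motion W \<longleftrightarrow>
     (\<forall>t\<ge>0. random_variable borel (W t)) \<and>
     (AE \<omega> in M. W 0 \<omega> = 0) \<and>
     (\<forall>s t. 0 \<le> s \<longrightarrow> s < t \<longrightarrow>
        distributed M lborel (\<lambda>\<omega>. W t \<omega> - W s \<omega>) (normal_density 0 (sqrt (t - s)))) \<and>
     (\<forall>n (t :: nat \<Rightarrow> real). 0 \<le> t 0 \<longrightarrow> (\<forall>k<n. t k \<le> t (Suc k)) \<longrightarrow>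
        indep_vars (\<lambda>_. borel) (\<lambda>k \<omega>. W (t (Suc k)) \<omega> - W (t k) \<omega>) {..<n}) \<and>
     (AE \<omega> in M. continuous_on {0..} (\<lambda>t. W t \<omega>))"

text \<open>
  Independence of the sigma-algebras generated by the whole processes, viewed as random elements
  of the path spaces. (The library's \<open>indep_var\<close> requires both to have the same value type.)
\<close>

definition (in prob_space) indep_processes ::
    "'b measure \<Rightarrow> (real \<Rightarrow> 'a \<Rightarrow> 'b) \<Rightarrow> 'c measure \<Rightarrow> (real \<Rightarrow> 'a \<Rightarrow> 'c) \<Rightarrow> bool" where
  "indep_processes S X T Y \<longleftrightarrow>
     indep_set
       {(\<lambda>\<omega>. \<lambda>t\<in>{0..}. X t \<omega>) -` A \<inter> space M | A. A \<in> sets (Pi\<^sub>M {0..} (\<lambda>_. S))}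
       {(\<lambda>\<omega>. \<lambda>t\<in>{0..}. Y t \<omega>) -` B \<inter> space M | B. B \<in> sets (Pi\<^sub>M {0..} (\<lambda>_. T))}"

text \<open>
  \<open>uniform_measure M {\<omega> \<in> space M. P \<omega>}\<close> is the elementary conditional probability given an
  event of positive probability. Nonnegativity is required separately because \<open>ennreal\<close>
  truncates negative values to \<open>0\<close>.
\<close>

definition has_conditional_density ::
    "'a measure \<Rightarrow> ('a \<Rightarrow> bool) \<Rightarrow> ('a \<Rightarrow> real) \<Rightarrow> (real \<Rightarrow> real) \<Rightarrow> bool" where
  "has_conditional_density M P X g \<longleftrightarrow>
     (\<forall>z. 0 \<le> g z) \<and>
     distributed (uniform_measure M {\<omega> \<in> space M. P \<omega>}) lborel X (\<lambda>z. ennreal (g z))"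

end

theory Submission
  imports Defs
begin

text \<open>
  Given \<open>\<epsilon>\<^sub>0 = 1\<close>, the drift \<open>\<integral>\<alpha>(\<epsilon>\<^sub>s) ds\<close> equals \<open>\<alpha>\<^sub>1 u + \<alpha>\<^sub>2 (h - u)\<close>, where \<open>u\<close> is the time spent
  in state \<open>1\<close> up to \<open>h\<close>, and \<open>Z\<close> is this drift plus an independent normal variable. The
  formulas say that \<open>u\<close> has an atom at \<open>h\<close>, from paths without a jump, and otherwise a density
  given by the Bessel series, whose \<open>k\<close>-th term comes from paths with a fixed number of jumps.
  Integrating a normal density against this law gives the density of \<open>Z\<close>.

  Jump times do not enter the definition of the chain, which gives its finite-dimensional
  distributions and paths that are locally constant to the right, so the law of \<open>u\<close> is
  identified through Fourier transforms. Replacing the drift by its Riemann sum over a grid with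
  \<open>n\<close> steps of length \<open>\<delta> = h / n\<close>, the Markov property shows that
  \<open>E[exp (\<i> \<theta> drift); \<epsilon>\<^sub>h = j | \<epsilon>\<^sub>0 = 1]\<close> becomes the entry \<open>(1, j)\<close> of the \<open>n\<close>-th power of the
  matrix with entries \<open>P\<^sub>i\<^sub>j(\<delta>) exp (\<i> \<theta> \<delta> \<alpha>\<^sub>j)\<close> (\<open>markov_chain_multiplicative_functional\<close>). This
  matrix is \<open>1 + \<delta> A + O(\<delta>\<^sup>2)\<close>, where \<open>A\<close> is the intensity matrix plus the diagonal matrix of the
  \<open>\<i> \<theta> \<alpha>\<^sub>i\<close>, and it does not increase the \<open>l\<^sup>1\<close> norm of row vectors. Hence its powers form a
  stable Euler scheme for \<open>v' = v A\<close> and converge to any solution with the right initial value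
  (\<open>matrix_steps_tendsto\<close>). On the left the Riemann sums converge to the drift path by path,
  because paths are locally constant to the right (\<open>right_constant_riemann_sums\<close>).

  It remains to know a solution: the Fourier transform of the claimed law. The two Bessel
  series, written in \<open>w = z\<^sup>2 / 4\<close>, satisfy \<open>K\<^sub>0' = K\<^sub>1\<close> and \<open>(w K\<^sub>1)' = K\<^sub>0\<close>, and with the Leibniz
  rule for an integral with a moving endpoint these identities turn into the two components of
  the equation (\<open>return_char_deriv\<close>, \<open>switch_char_deriv\<close>).

  The Brownian motion is independent of the chain and multiplies the transform by that of a
  normal law. The claimed densities have the same transforms by Fubini's theorem
  (\<open>gaussian_mixture_char\<close>), and Levy's uniqueness theorem concludes
  (\<open>has_conditional_densityI_char\<close>). The normalising constants come from \<open>exp (h Q)\<close>,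
  where the exponential series collapses because \<open>Q\<^sup>2\<close> is a multiple of \<open>Q\<close>.
\<close>

section \<open>The Leibniz rule with a moving endpoint\<close>

text \<open>
  The integral is a function of two variables, the parameter and the upper endpoint. Both
  partial derivatives exist and the one in the endpoint is continuous, so the chain rule along
  the diagonal applies. Differentiating within \<open>{0..T}\<close> covers the time \<open>0\<close>.
\<close>

lemma leibniz_rule_moving_endpoint:
  fixes F Fx :: "real \<Rightarrow> real \<Rightarrow> 'b::banach"
  assumes der: "\<And>x s. ((\<lambda>x. F x s) has_vector_derivative Fx x s) (at x)"
    and contF: "continuous_on UNIV (\<lambda>(x, s). F x s)"
    and contFx: "continuous_on UNIV (\<lambda>(x, s). Fx x s)"
    and t: "0 \<le> t" "t \<le> T"
  shows "((\<lambda>t. integral {0..t} (F t)) has_vector_derivative F t t + integral {0..t} (Fx t))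
           (at t within {0..T})"
proof -
  have contF1: "continuous_on X (F x)" for x X
    using continuous_on_compose2[OF contF, of X "Pair x"]
      continuous_on_Pair[OF continuous_on_const continuous_on_id, of X x] by simp
  have int: "(F x) integrable_on {a..b}" for x a b
    by (rule integrable_continuous_real[OF contF1])
  have "((\<lambda>(x, y). integral {0..y} (F x)) has_derivative
      (\<lambda>(tx, ty). tx *\<^sub>R integral {0..t} (Fx t) + blinfun_scaleR_left (F t t) ty))
      (at (t, t) within UNIV \<times> {0..T})"
  proof (rule has_derivative_partialsI[where fy = "\<lambda>x y. blinfun_scaleR_left (F x y)"])
    have "((\<lambda>x. integral (cbox 0 t) (F x)) has_vector_derivative integral (cbox 0 t) (Fx t))
        (at t within UNIV)"
    proof (rule leibniz_rule_vector_derivative)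
      show "continuous_on (UNIV \<times> cbox 0 t) (\<lambda>(x, t). Fx x t)"
        by (rule continuous_on_subset[OF contFx]) auto
    qed (use der int in auto)
    then show "((\<lambda>x. integral {0..t} (F x)) has_derivative (\<lambda>tx. tx *\<^sub>R integral {0..t} (Fx t)))
        (at t within UNIV)"
      by (simp add: has_vector_derivative_def)
  next
    fix x y :: real assume "y \<in> {0..T}"
    have "((\<lambda>y. integral {0..y} (F x)) has_vector_derivative F x y) (at y within {0..T})"
      by (rule integral_has_vector_derivative[OF contF1]) fact
    then show "((\<lambda>y. integral {0..y} (F x)) has_derivative blinfun_scaleR_left (F x y))
        (at y within {0..T})"
      by (simp add: has_vector_derivative_def)
  next
    have "continuous_on UNIV (\<lambda>p. blinfun_scaleR_left (case p of (x, y) \<Rightarrow> F x y))"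
      by (intro continuous_intros contF)
    then show "continuous (at (t, t) within UNIV \<times> {0..T}) (\<lambda>(x, y). blinfun_scaleR_left (F x y))"
      by (auto simp: split_beta' continuous_on_eq_continuous_within intro: continuous_within_subset)
  qed (use t in auto)
  moreover have "((\<lambda>t. (t, t)) has_derivative (\<lambda>x. (x, x))) (at t within {0..T})"
    by (auto intro!: derivative_eq_intros)
  ultimately have "((\<lambda>(x, y). integral {0..y} (F x)) \<circ> (\<lambda>t. (t, t)) has_derivative
      (\<lambda>(tx, ty). tx *\<^sub>R integral {0..t} (Fx t) + blinfun_scaleR_left (F t t) ty) \<circ> (\<lambda>x. (x, x)))
      (at t within {0..T})"
    by (intro diff_chain_within) (auto elim: has_derivative_subset)
  then show ?thesis
    by (simp add: has_vector_derivative_def o_def algebra_simps)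
qed

section \<open>The Bessel series as entire functions\<close>

text \<open>
  These are \<open>B\<^sub>0\<close> and, up to its factor \<open>z / 2\<close>, \<open>B\<^sub>1\<close> in the variable \<open>w = z\<^sup>2 / 4\<close>. In this
  variable they are everywhere convergent power series, tied together by \<open>K\<^sub>0' = K\<^sub>1\<close> and
  \<open>(w K\<^sub>1)' = K\<^sub>0\<close>. The differential equations below rest on these two identities.
\<close>

definition bessel_kernel0 :: "real \<Rightarrow> real" where
  "bessel_kernel0 w = (\<Sum>k. (1 / (fact k)\<^sup>2) * w ^ k)"

definition bessel_kernel1 :: "real \<Rightarrow> real" where
  "bessel_kernel1 w = (\<Sum>k. (1 / (fact k * fact (Suc k))) * w ^ k)"

lemma summable_bessel_coeffs:
  fixes w :: real
  assumes "\<And>k. 0 \<le> a k" "\<And>k. a k \<le> 1 / fact k"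
  shows "summable (\<lambda>k. a k * w ^ k)"
proof (rule summable_comparison_test[OF _ summable_exp[of "\<bar>w\<bar>"]], intro exI allI impI)
  fix k
  have "norm (a k * w ^ k) = a k * \<bar>w\<bar> ^ k"
    using assms(1)[of k] by (simp add: abs_mult power_abs)
  also have "\<dots> \<le> (1 / fact k) * \<bar>w\<bar> ^ k"
    using assms(2)[of k] by (intro mult_right_mono) auto
  finally show "norm (a k * w ^ k) \<le> inverse (fact k) * \<bar>w\<bar> ^ k"
    by (simp add: divide_inverse)
qed

lemma summable_bessel_kernel0: "summable (\<lambda>k. (1 / (fact k)\<^sup>2) * w ^ k)" for w :: real
proof (rule summable_bessel_coeffs)
  fix k :: nat
  have "(fact k :: real) * 1 \<le> fact k * fact k"
    by (intro mult_left_mono fact_ge_1) auto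
  then show "1 / (fact k)\<^sup>2 \<le> (1 / fact k :: real)"
    by (simp add: power2_eq_square frac_le)
qed simp

lemma summable_bessel_kernel1: "summable (\<lambda>k. (1 / (fact k * fact (Suc k))) * w ^ k)" for w :: real
proof (rule summable_bessel_coeffs)
  fix k :: nat
  have "(fact k :: real) * 1 \<le> fact k * fact (Suc k)"
    by (intro mult_left_mono fact_ge_1) auto
  then show "1 / (fact k * fact (Suc k)) \<le> (1 / fact k :: real)"
    by (intro frac_le) auto
qed simp

lemma bessel_kernel0_has_derivative:
  "(bessel_kernel0 has_real_derivative bessel_kernel1 w) (at w)"
proof -
  have "diffs (\<lambda>k. 1 / (fact k)\<^sup>2) = (\<lambda>k. 1 / (fact k * fact (Suc k)) :: real)"
    by (auto simp: diffs_def fun_eq_iff power2_eq_square divide_simps)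
  then show ?thesis
    using termdiffs_strong_converges_everywhere[OF summable_bessel_kernel0, of w]
    unfolding bessel_kernel0_def[abs_def] bessel_kernel1_def by simp
qed

text \<open>
  This is \<open>(w K\<^sub>1)' = K\<^sub>0\<close>, coefficientwise \<open>(k + 1) / (k! (k + 1)!) = 1 / (k!)\<^sup>2\<close>.
\<close>

lemma bessel_kernel1_has_derivative:
  obtains D where "(bessel_kernel1 has_real_derivative D) (at w)"
    "bessel_kernel1 w + w * D = bessel_kernel0 w"
proof -
  define a where "a k = (1 / (fact k * fact (Suc k)) :: real)" for k :: nat
  have s: "summable (\<lambda>k. a k * v ^ k)" for v
    unfolding a_def by (rule summable_bessel_kernel1)
  have K1: "bessel_kernel1 = (\<lambda>v. \<Sum>k. a k * v ^ k)"
    by (simp add: bessel_kernel1_def a_def fun_eq_iff)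
  have s': "summable (\<lambda>k. diffs a k * w ^ k)"
    by (rule termdiff_converges_all) (rule s)
  have "w * (\<Sum>k. diffs a k * w ^ k) = (\<Sum>k. of_nat k * a k * w ^ k)"
    and s'': "summable (\<lambda>k. of_nat k * a k * w ^ k)"
  proof -
    have "(\<lambda>k. w * (diffs a k * w ^ k)) sums (w * (\<Sum>k. diffs a k * w ^ k))"
      by (intro sums_mult summable_sums s')
    then have "(\<lambda>k. of_nat (Suc k) * a (Suc k) * w ^ (Suc k)) sums (w * (\<Sum>k. diffs a k * w ^ k))"
      by (simp add: diffs_def algebra_simps)
    then have *: "(\<lambda>k. of_nat k * a k * w ^ k) sums (w * (\<Sum>k. diffs a k * w ^ k))"
      by (subst (asm) sums_Suc_iff) simp
    show "w * (\<Sum>k. diffs a k * w ^ k) = (\<Sum>k. of_nat k * a k * w ^ k)"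
      using sums_unique[OF *] .
    show "summable (\<lambda>k. of_nat k * a k * w ^ k)"
      using sums_summable[OF *] .
  qed
  then have "bessel_kernel1 w + w * (\<Sum>k. diffs a k * w ^ k)
      = (\<Sum>k. a k * w ^ k + of_nat k * a k * w ^ k)"
    by (simp add: K1 suminf_add s)
  also have "(\<lambda>k. a k * w ^ k + of_nat k * a k * w ^ k) = (\<lambda>k. (1 / (fact k)\<^sup>2) * w ^ k)"
    by (auto simp: a_def fun_eq_iff power2_eq_square divide_simps) (simp add: algebra_simps)
  finally have "bessel_kernel1 w + w * (\<Sum>k. diffs a k * w ^ k) = bessel_kernel0 w"
    by (simp add: bessel_kernel0_def)
  moreover have "(bessel_kernel1 has_real_derivative (\<Sum>k. diffs a k * w ^ k)) (at w)"
    unfolding K1 by (rule termdiffs_strong_converges_everywhere) (rule s)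
  ultimately show ?thesis using that by blast
qed

lemma continuous_on_bessel_kernel0 [continuous_intros]:
  "continuous_on X f \<Longrightarrow> continuous_on X (\<lambda>x. bessel_kernel0 (f x))"
  by (rule continuous_on_compose2[of UNIV bessel_kernel0])
     (auto intro!: continuous_at_imp_continuous_on DERIV_isCont bessel_kernel0_has_derivative)

lemma continuous_on_bessel_kernel1 [continuous_intros]:
  "continuous_on X f \<Longrightarrow> continuous_on X (\<lambda>x. bessel_kernel1 (f x))"
  by (rule continuous_on_compose2[of UNIV bessel_kernel1])
     (auto intro!: continuous_at_imp_continuous_on intro: bessel_kernel1_has_derivative DERIV_isCont)

lemma bessel_kernel_zero [simp]: "bessel_kernel0 0 = 1" "bessel_kernel1 0 = 1"
  unfolding bessel_kernel0_def bessel_kernel1_def by (subst powser_zero, simp)+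

lemma bessel_kernel_nonneg:
  assumes "0 \<le> w" shows "0 \<le> bessel_kernel0 w" "0 \<le> bessel_kernel1 w"
  using assms summable_bessel_kernel0[of w] summable_bessel_kernel1[of w]
  by (auto simp: bessel_kernel0_def bessel_kernel1_def intro!: suminf_nonneg)

lemma bessel_B0_sqrt: "0 \<le> w \<Longrightarrow> bessel_B0 (sqrt w) = bessel_kernel0 (w / 4)"
  by (simp add: bessel_B0_def bessel_kernel0_def)

lemma bessel_B1_sqrt: "0 \<le> w \<Longrightarrow> bessel_B1 (sqrt w) = sqrt w / 2 * bessel_kernel1 (w / 4)"
  by (simp add: bessel_B1_def bessel_kernel1_def)

section \<open>The occupation time law solves the Kolmogorov equation\<close>

text \<open>
  With \<open>c = l1 * l2\<close> and \<open>\<kappa> = m2 - m1\<close>, the factor \<open>exp (\<kappa> u)\<close> carries, up to \<open>exp (- m2 t)\<close>,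
  both the holding probabilities and the Fourier phase of \<open>u\<close> time units spent in state \<open>1\<close> out
  of \<open>t\<close>.
\<close>

definition bessel_int0 :: "real \<Rightarrow> complex \<Rightarrow> real \<Rightarrow> complex" where
  "bessel_int0 c \<kappa> t = integral {0..t} (\<lambda>u. exp (\<kappa> * of_real u) * of_real (bessel_kernel0 (c * u * (t - u))))"

definition bessel_int1 :: "real \<Rightarrow> complex \<Rightarrow> real \<Rightarrow> complex" where
  "bessel_int1 c \<kappa> t = integral {0..t} (\<lambda>u. exp (\<kappa> * of_real u) * of_real (c * u * bessel_kernel1 (c * u * (t - u))))"

lemma bessel_int0_deriv:
  assumes "0 \<le> t" "t \<le> T"
  shows "(bessel_int0 c \<kappa> has_vector_derivative exp (\<kappa> * of_real t) + bessel_int1 c \<kappa> t)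
    (at t within {0..T})"
proof -
  have "((\<lambda>t. integral {0..t} (\<lambda>u. exp (\<kappa> * of_real u) * of_real (bessel_kernel0 (c * u * (t - u)))))
      has_vector_derivative
      exp (\<kappa> * of_real t) * of_real (bessel_kernel0 (c * t * (t - t))) + bessel_int1 c \<kappa> t) (at t within {0..T})"
    unfolding bessel_int1_def
  proof (rule leibniz_rule_moving_endpoint)
    fix x s :: real
    have "((\<lambda>x. bessel_kernel0 (c * s * (x - s))) has_real_derivative
        bessel_kernel1 (c * s * (x - s)) * (c * s)) (at x)"
      by (rule DERIV_chain2[OF bessel_kernel0_has_derivative]) (auto intro!: derivative_eq_intros)
    then have "((\<lambda>x. of_real (bessel_kernel0 (c * s * (x - s))) :: complex) has_vector_derivative
        of_real (bessel_kernel1 (c * s * (x - s)) * (c * s))) (at x)"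
      by (rule has_vector_derivative_of_real[unfolded has_real_derivative_iff_has_vector_derivative[symmetric]])
    from has_vector_derivative_mult_right[OF this, of "exp (\<kappa> * of_real s)"]
    show "((\<lambda>x. exp (\<kappa> * of_real s) * of_real (bessel_kernel0 (c * s * (x - s)))) has_vector_derivative
       exp (\<kappa> * of_real s) * of_real (c * s * bessel_kernel1 (c * s * (x - s)))) (at x)"
      by (simp add: mult_ac)
  qed (use assms in \<open>auto simp: split_beta' intro!: continuous_intros\<close>)
  then show ?thesis
    by (simp add: bessel_int0_def[abs_def])
qed

lemma integral_reflect_interval:
  fixes f :: "real \<Rightarrow> 'a::euclidean_space"
  assumes "f integrable_on {0..t}"
  shows "integral {0..t} (\<lambda>u. f (t - u)) = integral {0..t} f"
proof -
  have "(f has_integral integral {0..t} f) (cbox 0 t)"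
    using assms by (simp add: integrable_integral)
  from has_integral_affinity[OF this, of "-1" t]
  have "((\<lambda>u. f (t - u)) has_integral integral {0..t} f) ((\<lambda>u. t - u) ` {0..t})"
    by simp
  then show ?thesis
    by (simp add: image_diff_atLeastAtMost integral_unique)
qed

lemma exp_of_real_has_vector_derivative:
  "((\<lambda>t. exp (\<kappa> * of_real t)) has_vector_derivative \<kappa> * exp (\<kappa> * of_real t)) (at t within X)"
  for \<kappa> :: complex
  by (rule has_vector_derivative_real_field) (auto intro!: derivative_eq_intros)

text \<open>
  With \<open>m1 = l1 - \<i> \<theta> \<alpha>\<^sub>1\<close> and \<open>m2 = l2 - \<i> \<theta> \<alpha>\<^sub>2\<close> these are the Fourier transforms of the drift
  up to time \<open>t\<close>, for the chain started in \<open>1\<close> and found at time \<open>t\<close> in state \<open>1\<close>, respectively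
  \<open>2\<close>. The summand \<open>exp (- m1 t)\<close> is the chain that never jumps.
\<close>

definition return_char :: "real \<Rightarrow> real \<Rightarrow> complex \<Rightarrow> complex \<Rightarrow> real \<Rightarrow> complex" where
  "return_char l1 l2 m1 m2 t
     = exp (- m1 * of_real t) + exp (- m2 * of_real t) * bessel_int1 (l1 * l2) (m2 - m1) t"

definition switch_char :: "real \<Rightarrow> real \<Rightarrow> complex \<Rightarrow> complex \<Rightarrow> real \<Rightarrow> complex" where
  "switch_char l1 l2 m1 m2 t
     = of_real l1 * (exp (- m2 * of_real t) * bessel_int0 (l1 * l2) (m2 - m1) t)"

text \<open>
  Differentiating the integrand directly would produce the derivative of \<open>K\<^sub>1\<close>. After the
  reflection \<open>u \<mapsto> t - u\<close> the integrand contains \<open>(t - s) K\<^sub>1 (c s (t - s))\<close> instead, whose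
  derivative in \<open>t\<close> is \<open>K\<^sub>0 (c s (t - s))\<close> because \<open>(w K\<^sub>1)' = K\<^sub>0\<close>.
\<close>

lemma bessel_int1_deriv:
  assumes "0 \<le> t" "t \<le> T"
  shows "(bessel_int1 c \<kappa> has_vector_derivative \<kappa> * bessel_int1 c \<kappa> t + of_real c * bessel_int0 c \<kappa> t)
    (at t within {0..T})"
proof -
  define J where "J t = integral {0..t} (\<lambda>s. exp (- \<kappa> * of_real s) * of_real (c * (t - s) * bessel_kernel1 (c * s * (t - s))))" for t
  have refl0: "integral {0..t} (\<lambda>s. exp (- \<kappa> * of_real s) * of_real (c * bessel_kernel0 (c * s * (t - s))))
     = of_real c * exp (- \<kappa> * of_real t) * bessel_int0 c \<kappa> t" for t
  proof -
    have "bessel_int0 c \<kappa> t = integral {0..t} (\<lambda>s. exp (\<kappa> * of_real (t - s)) * of_real (bessel_kernel0 (c * (t - s) * (t - (t - s)))))"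
      unfolding bessel_int0_def 
      by (rule integral_reflect_interval[symmetric])
        (auto intro!: integrable_continuous_real continuous_intros)
    then show ?thesis
      by (simp flip: integral_mult_right add: exp_minus exp_diff divide_simps algebra_simps)
  qed
  have refl1: "bessel_int1 c \<kappa> t = exp (\<kappa> * of_real t) * J t" for t
  proof -
    have "bessel_int1 c \<kappa> t = integral {0..t} (\<lambda>s. exp (\<kappa> * of_real (t - s)) * of_real (c * (t - s) * bessel_kernel1 (c * (t - s) * (t - (t - s)))))"
      unfolding bessel_int1_def 
      by (rule integral_reflect_interval[symmetric])
        (auto intro!: integrable_continuous_real continuous_intros)
    then show ?thesis
      by (simp add: J_def flip: integral_mult_right)
         (simp add: exp_minus exp_diff divide_simps algebra_simps)
  qed
  have "(J has_vector_derivative exp (- \<kappa> * of_real t) * of_real (c * (t - t) * bessel_kernel1 (c * t * (t - t)))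
      + integral {0..t} (\<lambda>s. exp (- \<kappa> * of_real s) * of_real (c * bessel_kernel0 (c * s * (t - s))))) (at t within {0..T})"
    unfolding J_def[abs_def]
  proof (rule leibniz_rule_moving_endpoint)
    fix x s :: real
    obtain D where D: "(bessel_kernel1 has_real_derivative D) (at (c * s * (x - s)))"
      and eq: "bessel_kernel1 (c * s * (x - s)) + (c * s * (x - s)) * D = bessel_kernel0 (c * s * (x - s))"
      using bessel_kernel1_has_derivative by blast
    have "((\<lambda>x. bessel_kernel1 (c * s * (x - s))) has_real_derivative D * (c * s)) (at x)"
      by (rule DERIV_chain2[of bessel_kernel1 D "\<lambda>x. c * s * (x - s)" x "c * s", OF D]) (auto intro!: derivative_eq_intros)
    then have "((\<lambda>x. c * (x - s) * bessel_kernel1 (c * s * (x - s))) has_real_derivative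
        c * (bessel_kernel1 (c * s * (x - s)) + (c * s * (x - s)) * D)) (at x)"
      by (auto intro!: derivative_eq_intros simp: algebra_simps)
    then have "((\<lambda>x. of_real (c * (x - s) * bessel_kernel1 (c * s * (x - s))) :: complex) has_vector_derivative
        of_real (c * bessel_kernel0 (c * s * (x - s)))) (at x)"
      unfolding eq
      by (rule has_vector_derivative_of_real[unfolded has_real_derivative_iff_has_vector_derivative[symmetric]])
    from has_vector_derivative_mult_right[OF this, of "exp (- \<kappa> * of_real s)"]
    show "((\<lambda>x. exp (- \<kappa> * of_real s) * of_real (c * (x - s) * bessel_kernel1 (c * s * (x - s)))) has_vector_derivative
       exp (- \<kappa> * of_real s) * of_real (c * bessel_kernel0 (c * s * (x - s)))) (at x)" .
  qed (use assms in \<open>auto simp: split_beta' intro!: continuous_intros\<close>)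
  then have "(J has_vector_derivative of_real c * exp (- \<kappa> * of_real t) * bessel_int0 c \<kappa> t) (at t within {0..T})"
    unfolding refl0 by simp
  moreover have "((\<lambda>t. exp (\<kappa> * of_real t)) has_vector_derivative \<kappa> * exp (\<kappa> * of_real t)) (at t within {0..T})"
    by (rule exp_of_real_has_vector_derivative)
  ultimately have "((\<lambda>t. exp (\<kappa> * of_real t) * J t) has_vector_derivative
     exp (\<kappa> * of_real t) * (of_real c * exp (- \<kappa> * of_real t) * bessel_int0 c \<kappa> t) + \<kappa> * exp (\<kappa> * of_real t) * J t) (at t within {0..T})"
    by (intro has_vector_derivative_mult)
  then show ?thesis
    unfolding refl1[abs_def] by (simp add: exp_minus algebra_simps)
qed

text \<open>
  This lemma and the next say that the row vector of the two transforms satisfies \<open>v' = v A\<close>,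
  where \<open>A\<close> is the intensity matrix plus the diagonal matrix of the \<open>\<i> \<theta> \<alpha>\<^sub>i\<close>.
\<close>

lemma switch_char_deriv:
  assumes "0 \<le> t" "t \<le> T"
  shows "(switch_char l1 l2 m1 m2 has_vector_derivative
     of_real l1 * return_char l1 l2 m1 m2 t - m2 * switch_char l1 l2 m1 m2 t) (at t within {0..T})"
proof -
  have "exp (- m2 * of_real t) * exp ((m2 - m1) * of_real t) = exp (- m1 * of_real t)"
    by (simp flip: exp_add add: algebra_simps)
  then have "of_real l1 * (exp (- m2 * of_real t) * (exp ((m2 - m1) * of_real t) + bessel_int1 (l1 * l2) (m2 - m1) t)
        + - m2 * exp (- m2 * of_real t) * bessel_int0 (l1 * l2) (m2 - m1) t)
      = of_real l1 * return_char l1 l2 m1 m2 t - m2 * switch_char l1 l2 m1 m2 t"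
    by (simp add: return_char_def switch_char_def algebra_simps)
  with has_vector_derivative_mult_right[OF has_vector_derivative_mult[OF
        exp_of_real_has_vector_derivative[of "- m2" t "{0..T}"]
        bessel_int0_deriv[OF assms, of "l1 * l2" "m2 - m1"]], of "of_real l1"]
  show ?thesis by (simp add: switch_char_def[abs_def])
qed

lemma return_char_deriv:
  assumes "0 \<le> t" "t \<le> T"
  shows "(return_char l1 l2 m1 m2 has_vector_derivative
     - m1 * return_char l1 l2 m1 m2 t + of_real l2 * switch_char l1 l2 m1 m2 t) (at t within {0..T})"
proof -
  have "- m1 * exp (- m1 * of_real t) + (exp (- m2 * of_real t) * ((m2 - m1) * bessel_int1 (l1 * l2) (m2 - m1) t
          + of_real (l1 * l2) * bessel_int0 (l1 * l2) (m2 - m1) t)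
        + - m2 * exp (- m2 * of_real t) * bessel_int1 (l1 * l2) (m2 - m1) t)
      = - m1 * return_char l1 l2 m1 m2 t + of_real l2 * switch_char l1 l2 m1 m2 t"
    by (simp add: return_char_def switch_char_def algebra_simps)
  with has_vector_derivative_add[OF exp_of_real_has_vector_derivative[of "- m1" t "{0..T}"]
     has_vector_derivative_mult[OF exp_of_real_has_vector_derivative[of "- m2" t "{0..T}"]
        bessel_int1_deriv[OF assms, of "l1 * l2" "m2 - m1"]]]
  show ?thesis by (simp add: return_char_def[abs_def])
qed

lemma telegraph_char_0 [simp]: "return_char l1 l2 m1 m2 0 = 1" "switch_char l1 l2 m1 m2 0 = 0"
  by (simp_all add: return_char_def switch_char_def bessel_int0_def bessel_int1_def)

section \<open>Powers of nearly infinitesimal matrices\<close>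

lemma onorm_scaleR_left_le:
  assumes "norm v \<le> K" shows "onorm (\<lambda>h::real. h *\<^sub>R v) \<le> K"
proof (rule onorm_le)
  fix h :: real
  show "norm (h *\<^sub>R v) \<le> K * norm h"
    using mult_right_mono[OF assms, of "\<bar>h\<bar>"] by (simp add: mult.commute)
qed

text \<open>
  A bound that is uniform in the base point: the errors of all steps of an Euler scheme on
  \<open>{0..T}\<close> are added up later.
\<close>

lemma second_order_remainder:
  fixes f :: "real \<Rightarrow> 'a::real_normed_vector"
  assumes f: "\<And>t. 0 \<le> t \<Longrightarrow> t \<le> T \<Longrightarrow> (f has_vector_derivative f' t) (at t within {0..T})"
    and f': "\<And>t. 0 \<le> t \<Longrightarrow> t \<le> T \<Longrightarrow> (f' has_vector_derivative f'' t) (at t within {0..T})"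
    and cont: "continuous_on {0..T} f''"
  obtains C where "0 \<le> C"
    "\<And>s t. 0 \<le> s \<Longrightarrow> s \<le> t \<Longrightarrow> t \<le> T \<Longrightarrow> norm (f t - f s - (t - s) *\<^sub>R f' s) \<le> C * (t - s)\<^sup>2"
proof -
  have "bounded (f'' ` {0..T})"
    by (intro compact_imp_bounded compact_continuous_image cont) simp
  then obtain B where B: "0 < B" "\<And>t. t \<in> {0..T} \<Longrightarrow> norm (f'' t) \<le> B"
    by (auto simp: bounded_pos)
  have f'_lip: "norm (f' t - f' s) \<le> B * (t - s)" if "0 \<le> s" "s \<le> t" "t \<le> T" for s t
  proof -
    have "norm (f' t - f' s) \<le> B * norm (t - s)"
    proof (rule differentiable_bound[of "{s..t}" f' "\<lambda>x h. h *\<^sub>R f'' x"])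
      fix x assume "x \<in> {s..t}"
      then show "(f' has_derivative (\<lambda>h. h *\<^sub>R f'' x)) (at x within {s..t})"
        using that f'[of x] by (auto simp: has_vector_derivative_def elim!: has_derivative_subset)
      show "onorm (\<lambda>h. h *\<^sub>R f'' x) \<le> B"
        using that \<open>x \<in> {s..t}\<close> by (intro onorm_scaleR_left_le B) auto
    qed (use that in auto)
    then show ?thesis using that by simp
  qed
  have "norm (f t - f s - (t - s) *\<^sub>R f' s) \<le> B * (t - s)\<^sup>2" if "0 \<le> s" "s \<le> t" "t \<le> T" for s t
  proof -
    define g where "g x = f x - x *\<^sub>R f' s" for x
    have "norm (g t - g s) \<le> (B * (t - s)) * norm (t - s)"
    proof (rule differentiable_bound[of "{s..t}" g "\<lambda>x h. h *\<^sub>R (f' x - f' s)"])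
      fix x assume x: "x \<in> {s..t}"
      have "(f has_vector_derivative f' x) (at x within {s..t})"
        using that f[of x] x by (auto simp: has_vector_derivative_def elim!: has_derivative_subset)
      then have "(g has_vector_derivative (f' x - f' s)) (at x within {s..t})"
        unfolding g_def[abs_def] by (auto intro!: derivative_eq_intros)
      then show "(g has_derivative (\<lambda>h. h *\<^sub>R (f' x - f' s))) (at x within {s..t})"
        by (simp add: has_vector_derivative_def)
      have "norm (f' x - f' s) \<le> B * (x - s)"
        using f'_lip[of s x] that x by auto
      also have "\<dots> \<le> B * (t - s)"
        using x B by (intro mult_left_mono) auto
      finally show "onorm (\<lambda>h. h *\<^sub>R (f' x - f' s)) \<le> B * (t - s)"
        by (rule onorm_scaleR_left_le)
    qed (use that in auto)
    then show ?thesis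
      using that by (simp add: g_def algebra_simps power2_eq_square)
  qed
  with B that show ?thesis by (meson less_imp_le)
qed

text \<open>
  The entries of the \<open>k\<close>-th power of the matrix \<open>m\<close>. The recursion peels off the first step, as
  the Markov property does; the error analysis of the scheme needs the last step, hence the
  lemma that follows. Matrices are plain functions because complex entries occur.
\<close>

primrec matrix_steps :: "('n \<Rightarrow> 'n \<Rightarrow> complex) \<Rightarrow> nat \<Rightarrow> 'n::finite \<Rightarrow> 'n \<Rightarrow> complex" where
  "matrix_steps m 0 = (\<lambda>i j. of_bool (i = j))"
| "matrix_steps m (Suc k) = (\<lambda>i j. \<Sum>l\<in>UNIV. m i l * matrix_steps m k l j)"

lemma matrix_steps_Suc_right:
  "matrix_steps m (Suc k) i j = (\<Sum>l\<in>UNIV. matrix_steps m k i l * m l j)"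
proof (induction k arbitrary: i)
  case 0
  have "(\<Sum>l\<in>UNIV. m i l * of_bool (l = j)) = m i j"
    using sum.delta'[of UNIV j "m i"] by (simp add: of_bool_def if_distrib cong: if_cong)
  moreover have "(\<Sum>l\<in>UNIV. of_bool (i = l) * m l j) = m i j"
  proof -
    have "of_bool (i = l) * m l j = (if i = l then m l j else 0)" for l by simp
    then show ?thesis by simp
  qed
  ultimately show ?case by simp
next
  case (Suc k)
  have "matrix_steps m (Suc (Suc k)) i j = (\<Sum>l\<in>UNIV. m i l * (\<Sum>l'\<in>UNIV. matrix_steps m k l l' * m l' j))"
    using Suc by simp
  also have "\<dots> = (\<Sum>l'\<in>UNIV. \<Sum>l\<in>UNIV. m i l * (matrix_steps m k l l' * m l' j))"
    by (simp add: sum_distrib_left) (rule sum.swap)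
  finally show ?case
    by (simp add: sum_distrib_right mult.assoc)
qed

text \<open>
  A one-step matrix that agrees with \<open>1 + \<delta> A\<close> up to \<open>O(\<delta>\<^sup>2)\<close> and does not increase the \<open>l\<^sup>1\<close> norm
  of row vectors gives a consistent and stable scheme for \<open>v' = v A\<close>: every step adds an error
  \<open>K \<delta>\<^sup>2\<close>, and \<open>n\<close> steps of length \<open>T / n\<close> accumulate \<open>K T\<^sup>2 / n\<close>.
\<close>

lemma matrix_steps_tendsto:
  fixes A :: "'n::finite \<Rightarrow> 'n \<Rightarrow> complex" and m :: "real \<Rightarrow> 'n \<Rightarrow> 'n \<Rightarrow> complex"
    and v :: "'n \<Rightarrow> real \<Rightarrow> complex"
  assumes T: "0 < T"
    and v0: "\<And>j. v j 0 = of_bool (i0 = j)"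
    and v': "\<And>j t. 0 \<le> t \<Longrightarrow> t \<le> T \<Longrightarrow>
        (v j has_vector_derivative (\<Sum>i\<in>UNIV. v i t * A i j)) (at t within {0..T})"
    and m: "\<And>\<delta> i j. 0 \<le> \<delta> \<Longrightarrow> \<delta> \<le> T \<Longrightarrow>
        norm (m \<delta> i j - (of_bool (i = j) + of_real \<delta> * A i j)) \<le> C * \<delta>\<^sup>2"
    and m1: "\<And>\<delta> i. 0 \<le> \<delta> \<Longrightarrow> \<delta> \<le> T \<Longrightarrow> (\<Sum>j\<in>UNIV. norm (m \<delta> i j)) \<le> 1"
  shows "(\<lambda>n. matrix_steps (m (T / real n)) n i0 j) \<longlonglongrightarrow> v j T"
proof -
  define v1 where "v1 j t = (\<Sum>i\<in>UNIV. v i t * A i j)" for j t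
  define v2 where "v2 j t = (\<Sum>i\<in>UNIV. v1 i t * A i j)" for j t
  have v'': "(v1 j has_vector_derivative v2 j t) (at t within {0..T})" if "0 \<le> t" "t \<le> T" for j t
    unfolding v1_def[abs_def] v2_def
    by (intro has_vector_derivative_sum has_vector_derivative_mult_left v' that)
  have cont: "continuous_on {0..T} (v j)" for j
    using v' by (auto intro!: continuous_on_vector_derivative)
  have "\<exists>C\<ge>0. \<forall>s t. 0 \<le> s \<longrightarrow> s \<le> t \<longrightarrow> t \<le> T \<longrightarrow>
      norm (v j t - v j s - (t - s) *\<^sub>R v1 j s) \<le> C * (t - s)\<^sup>2" for j
  proof (rule second_order_remainder[of T "v j" "v1 j" "v2 j"])
    show "continuous_on {0..T} (v2 j)"
      unfolding v2_def[abs_def] v1_def by (intro continuous_intros cont)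
  qed (use v' v'' in \<open>auto simp: v1_def\<close>)
  then obtain R where R0: "\<And>j. 0 \<le> R j" and R: "\<And>j s t. 0 \<le> s \<Longrightarrow> s \<le> t \<Longrightarrow> t \<le> T \<Longrightarrow>
      norm (v j t - v j s - (t - s) *\<^sub>R v1 j s) \<le> R j * (t - s)\<^sup>2"
    by metis
  have "\<exists>B\<ge>0. \<forall>t\<in>{0..T}. norm (v j t) \<le> B" for j
  proof -
    have "bounded (v j ` {0..T})"
      by (intro compact_imp_bounded compact_continuous_image cont) simp
    then obtain B where "0 < B" "\<forall>x\<in>v j ` {0..T}. norm x \<le> B"
      by (auto simp: bounded_pos)
    then show ?thesis by (intro exI[of _ B]) auto
  qed
  then obtain B where B0: "\<And>j. 0 \<le> B j" and B: "\<And>j t. t \<in> {0..T} \<Longrightarrow> norm (v j t) \<le> B j"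
    by metis
  have C0: "0 \<le> C"
  proof -
    have "0 \<le> C * T\<^sup>2"
      using m[of T i0 i0] T by (intro order_trans[OF norm_ge_zero]) auto
    then show ?thesis using T by (simp add: zero_le_mult_iff)
  qed
  define K where "K = (\<Sum>j\<in>UNIV. (\<Sum>i\<in>UNIV. B i * C) + R j)"
  have step: "(\<Sum>j\<in>UNIV. norm (matrix_steps (m \<delta>) (Suc k) i0 j - v j (real (Suc k) * \<delta>)))
      \<le> (\<Sum>j\<in>UNIV. norm (matrix_steps (m \<delta>) k i0 j - v j (real k * \<delta>))) + K * \<delta>\<^sup>2"
    if \<delta>: "0 \<le> \<delta>" "\<delta> \<le> T" "real (Suc k) * \<delta> \<le> T" for k \<delta>
  proof -
    define s where "s = real k * \<delta>"
    have s: "0 \<le> s" "s \<le> s + \<delta>" "s + \<delta> \<le> T" and s_Suc: "real (Suc k) * \<delta> = s + \<delta>"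
      using \<delta> by (auto simp: s_def algebra_simps)
    define w where "w = matrix_steps (m \<delta>) k i0"
    have le: "norm (matrix_steps (m \<delta>) (Suc k) i0 j - v j (s + \<delta>))
        \<le> (\<Sum>i\<in>UNIV. norm (w i - v i s) * norm (m \<delta> i j)) + ((\<Sum>i\<in>UNIV. B i * C) + R j) * \<delta>\<^sup>2" for j
    proof -
      define r where "r i = m \<delta> i j - (of_bool (i = j) + of_real \<delta> * A i j)" for i
      have r: "norm (r i) \<le> C * \<delta>\<^sup>2" for i
        unfolding r_def by (rule m[OF \<delta>(1,2)])
      have vj: "v j s = (\<Sum>i\<in>UNIV. v i s * of_bool (i = j))"
        by (simp add: of_bool_def if_distrib cong: if_cong)
      have "(\<Sum>i\<in>UNIV. v i s * m \<delta> i j) = v j s + \<delta> *\<^sub>R v1 j s + (\<Sum>i\<in>UNIV. v i s * r i)"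
        unfolding r_def v1_def
        by (simp add: vj[symmetric] sum.distrib sum_subtractf scaleR_conv_of_real sum_distrib_left algebra_simps)
      then have "matrix_steps (m \<delta>) (Suc k) i0 j - v j (s + \<delta>)
          = (\<Sum>i\<in>UNIV. (w i - v i s) * m \<delta> i j) + (\<Sum>i\<in>UNIV. v i s * r i)
            - (v j (s + \<delta>) - v j s - \<delta> *\<^sub>R v1 j s)"
        unfolding matrix_steps_Suc_right w_def
        by (simp add: sum_subtractf algebra_simps)
      also have "norm \<dots> \<le> (\<Sum>i\<in>UNIV. norm ((w i - v i s) * m \<delta> i j)) + (\<Sum>i\<in>UNIV. norm (v i s * r i))
            + norm (v j (s + \<delta>) - v j s - \<delta> *\<^sub>R v1 j s)"
        by (intro norm_triangle_le_diff add_mono norm_triangle_le norm_sum order_refl)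
      also have "\<dots> \<le> (\<Sum>i\<in>UNIV. norm ((w i - v i s) * m \<delta> i j)) + (\<Sum>i\<in>UNIV. B i * (C * \<delta>\<^sup>2)) + R j * \<delta>\<^sup>2"
        using R[of s "s + \<delta>" j] s B[of s] r B0 C0
        by (intro add_mono order_refl sum_mono) (auto simp: norm_mult intro!: mult_mono)
      finally show ?thesis
        unfolding norm_mult
        by (simp add: distrib_right sum_distrib_right mult.assoc add.assoc del: matrix_steps.simps)
    qed
    have "(\<Sum>j\<in>UNIV. norm (matrix_steps (m \<delta>) (Suc k) i0 j - v j (s + \<delta>)))
        \<le> (\<Sum>j\<in>UNIV. (\<Sum>i\<in>UNIV. norm (w i - v i s) * norm (m \<delta> i j)) + ((\<Sum>i\<in>UNIV. B i * C) + R j) * \<delta>\<^sup>2)"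
      by (intro sum_mono le)
    also have "\<dots> = (\<Sum>j\<in>UNIV. \<Sum>i\<in>UNIV. norm (w i - v i s) * norm (m \<delta> i j)) + K * \<delta>\<^sup>2"
      by (simp only: sum.distrib K_def sum_distrib_right distrib_right)
    also have "(\<Sum>j\<in>UNIV. \<Sum>i\<in>UNIV. norm (w i - v i s) * norm (m \<delta> i j))
        = (\<Sum>i\<in>UNIV. norm (w i - v i s) * (\<Sum>j\<in>UNIV. norm (m \<delta> i j)))"
      by (subst sum.swap) (simp add: sum_distrib_left)
    also have "\<dots> \<le> (\<Sum>i\<in>UNIV. norm (w i - v i s) * 1)"
      by (intro sum_mono mult_left_mono m1 \<delta>) auto
    finally show ?thesis
      by (simp only: s_Suc w_def mult_1_right flip: s_def)
  qed
  have err: "(\<Sum>j\<in>UNIV. norm (matrix_steps (m \<delta>) k i0 j - v j (real k * \<delta>))) \<le> real k * (K * \<delta>\<^sup>2)"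
    if \<delta>: "0 \<le> \<delta>" "\<delta> \<le> T" "real k * \<delta> \<le> T" for k \<delta>
    using that(3)
  proof (induction k)
    case 0
    then show ?case by (simp add: v0)
  next
    case (Suc k)
    have "real k * \<delta> \<le> T" using Suc.prems \<delta>(1) by (auto simp: algebra_simps)
    with Suc.IH step[OF \<delta>(1,2) Suc.prems] show ?case by (simp add: algebra_simps)
  qed
  have bound: "norm (matrix_steps (m (T / real n)) n i0 j - v j T) \<le> K * T\<^sup>2 / real n" if "n > 0" for n
  proof -
    have "norm (matrix_steps (m (T / real n)) n i0 j - v j (real n * (T / real n)))
        \<le> (\<Sum>j\<in>UNIV. norm (matrix_steps (m (T / real n)) n i0 j - v j (real n * (T / real n))))"
      by (rule member_le_sum) auto
    also have "\<dots> \<le> real n * (K * (T / real n)\<^sup>2)"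
      using T that by (intro err) (auto simp: field_simps)
    also have "\<dots> = K * T\<^sup>2 / real n"
      using that by (simp add: power2_eq_square)
    finally show ?thesis using that by simp
  qed
  have "(\<lambda>n. matrix_steps (m (T / real n)) n i0 j - v j T) \<longlonglongrightarrow> 0"
  proof (rule tendsto_0_le[where K = 1 and f = "\<lambda>n. K * T\<^sup>2 / real n"])
    show "(\<lambda>n. K * T\<^sup>2 / real n) \<longlonglongrightarrow> 0"
      by (rule lim_const_over_n)
    show "\<forall>\<^sub>F n in sequentially. norm (matrix_steps (m (T / real n)) n i0 j - v j T)
        \<le> norm (K * T\<^sup>2 / real n) * 1"
      using eventually_gt_at_top[of "0::nat"]
    proof eventually_elim
      case (elim n)
      show ?case
        using order_trans[OF bound[OF elim] abs_ge_self] by simp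
    qed
  qed
  then show ?thesis by (simp add: Lim_null[symmetric])
qed

section \<open>The two-state transition matrix\<close>

lemma intensity_matrix_simps [simp]:
  "intensity_matrix l1 l2 $ 1 $ 1 = - l1" "intensity_matrix l1 l2 $ 1 $ 2 = l1"
  "intensity_matrix l1 l2 $ 2 $ 1 = l2" "intensity_matrix l1 l2 $ 2 $ 2 = - l2"
  by (simp_all add: intensity_matrix_def)

text \<open>
  \<open>Q ** Q = - (l1 + l2) *\<^sub>R Q\<close>, so the exponential series collapses to a scalar one.
\<close>

lemma matrix_exp_intensity_matrix:
  assumes "l1 > 0" "l2 > 0"
  shows "matrix_exp (t *\<^sub>R intensity_matrix l1 l2)
      = mat 1 + ((1 - exp (- (l1 + l2) * t)) / (l1 + l2)) *\<^sub>R intensity_matrix l1 l2"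
proof -
  define Q where "Q = intensity_matrix l1 l2"
  define L where "L = l1 + l2"
  have L: "L \<noteq> 0" using assms by (simp add: L_def)
  have QQ: "Q ** Q = (- L) *\<^sub>R Q"
    by (simp add: vec_eq_iff forall_2 matrix_matrix_mult_def sum_2 Q_def L_def algebra_simps)
  have pow: "((**) (t *\<^sub>R Q) ^^ Suc k) (mat 1) = (- (((- L * t) ^ Suc k) / L)) *\<^sub>R Q" for k
  proof (induction k)
    case (Suc k)
    have "((**) (t *\<^sub>R Q) ^^ Suc (Suc k)) (mat 1) = (t *\<^sub>R Q) ** ((- (((- L * t) ^ Suc k) / L)) *\<^sub>R Q)"
      using Suc by simp
    also have "\<dots> = (- (((- L * t) ^ Suc k) / L) * t) *\<^sub>R (Q ** Q)"
      by (simp only: matrix_scalar_ac scalar_matrix_assoc[symmetric] scaleR_scaleR)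
    finally show ?case by (simp add: QQ)
  qed (use L in simp)
  \<comment> \<open>Written with \<open>- Q / L\<close>, the powers follow one formula for all \<open>k\<close>; only the term \<open>k = 0\<close> needs a correction.\<close>
  have "(\<lambda>k. ((- L * t) ^ k /\<^sub>R fact k) *\<^sub>R (- (1 / L) *\<^sub>R Q) + (if k = 0 then mat 1 + (1 / L) *\<^sub>R Q else 0))
      sums (exp (- L * t) *\<^sub>R (- (1 / L) *\<^sub>R Q) + (mat 1 + (1 / L) *\<^sub>R Q))"
    by (intro sums_add sums_scaleR_left exp_converges sums_single)
  also have "(\<lambda>k. ((- L * t) ^ k /\<^sub>R fact k) *\<^sub>R (- (1 / L) *\<^sub>R Q) + (if k = 0 then mat 1 + (1 / L) *\<^sub>R Q else 0))
     = (\<lambda>k. (1 / fact k) *\<^sub>R (((**) (t *\<^sub>R Q) ^^ k) (mat 1)))"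
  proof
    fix k
    show "((- L * t) ^ k /\<^sub>R fact k) *\<^sub>R (- (1 / L) *\<^sub>R Q) + (if k = 0 then mat 1 + (1 / L) *\<^sub>R Q else 0)
       = (1 / fact k) *\<^sub>R (((**) (t *\<^sub>R Q) ^^ k) (mat 1))"
      by (cases k) (simp, simp add: pow divide_simps del: funpow.simps power_Suc)
  qed
  also have "exp (- L * t) *\<^sub>R (- (1 / L) *\<^sub>R Q) + (mat 1 + (1 / L) *\<^sub>R Q)
      = mat 1 + ((1 - exp (- L * t)) / L) *\<^sub>R Q"
    by (simp add: vec_eq_iff diff_divide_distrib algebra_simps)
  finally show ?thesis
    unfolding matrix_exp_def by (simp add: sums_iff Q_def L_def)
qed

text \<open>
  The hypotheses of \<open>matrix_steps_tendsto\<close> for the transition matrix with its columns multiplied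
  by the phases \<open>exp (\<i> \<theta> \<delta> \<alpha>\<^sub>j)\<close>. The phases have modulus \<open>1\<close>, so stability is that the
  transition matrix is stochastic. Consistency is a Taylor expansion at \<open>0\<close> of an entry, which
  is a combination \<open>a exp (p \<delta>) + b exp (q \<delta>)\<close>.
\<close>

lemma two_state_step_bounds:
  fixes \<alpha> :: "2 \<Rightarrow> real" and \<theta> :: real
  assumes l: "l1 > 0" "l2 > 0" and T: "0 < T"
  defines "P \<equiv> (\<lambda>t. matrix_exp (t *\<^sub>R intensity_matrix l1 l2))"
  shows two_state_transition_nonneg: "0 \<le> t \<Longrightarrow> 0 \<le> P t $ i $ j"
    and two_state_transition_rows: "(\<Sum>j\<in>UNIV. P t $ i $ j) = 1"
    and two_state_step_expansion: "\<exists>C. \<forall>\<delta> i j. 0 \<le> \<delta> \<longrightarrow> \<delta> \<le> T \<longrightarrow>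
      norm (of_real (P \<delta> $ i $ j) * exp (\<i> * of_real (\<theta> * \<delta> * \<alpha> j))
        - (of_bool (i = j) + of_real \<delta> * (of_real (intensity_matrix l1 l2 $ i $ j) + of_bool (i = j) * (\<i> * of_real (\<theta> * \<alpha> j)))))
      \<le> C * \<delta>\<^sup>2"
proof -
  define L where "L = l1 + l2"
  have L: "0 < L" using l by (simp add: L_def)
  let ?Q = "intensity_matrix l1 l2"
  have P: "P t $ i $ j = of_bool (i = j) + (1 - exp (- L * t)) / L * ?Q $ i $ j" for t i j
    by (simp add: P_def matrix_exp_intensity_matrix[OF l] mat_def L_def)
  show "0 \<le> P t $ i $ j" if "0 \<le> t"
  proof -
    have e: "0 \<le> 1 - exp (- L * t)" using L that by simp
    have "1 - L * t \<le> exp (- L * t)" using exp_ge_add_one_self[of "- L * t"] by simp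
    have k: "0 \<le> (1 - exp (- L * t)) / L" using e L by simp
    have "x * ((1 - exp (- L * t)) / L) \<le> 1" if "0 \<le> x" "x \<le> L" for x
    proof -
      have "x * ((1 - exp (- L * t)) / L) \<le> L * ((1 - exp (- L * t)) / L)"
        using that k by (intro mult_right_mono)
      also have "\<dots> \<le> 1" using L by simp
      finally show ?thesis .
    qed
    from this[of l1] this[of l2] mult_nonneg_nonneg[OF less_imp_le[OF l(1)] k]
      mult_nonneg_nonneg[OF less_imp_le[OF l(2)] k] l
    show ?thesis
      unfolding P using exhaust_2[of i] exhaust_2[of j]
      by (auto simp: L_def mult.commute)
  qed
  show "(\<Sum>j\<in>UNIV. P t $ i $ j) = 1"
    unfolding P using exhaust_2[of i] by (auto simp: sum_2)
  show "\<exists>C. \<forall>\<delta> i j. 0 \<le> \<delta> \<longrightarrow> \<delta> \<le> T \<longrightarrow>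
      norm (of_real (P \<delta> $ i $ j) * exp (\<i> * of_real (\<theta> * \<delta> * \<alpha> j))
        - (of_bool (i = j) + of_real \<delta> * (of_real (?Q $ i $ j) + of_bool (i = j) * (\<i> * of_real (\<theta> * \<alpha> j)))))
      \<le> C * \<delta>\<^sup>2"
  proof -
    have "\<exists>C\<ge>0. \<forall>\<delta>. 0 \<le> \<delta> \<longrightarrow> \<delta> \<le> T \<longrightarrow>
      norm (of_real (P \<delta> $ i $ j) * exp (\<i> * of_real (\<theta> * \<delta> * \<alpha> j))
        - (of_bool (i = j) + of_real \<delta> * (of_real (?Q $ i $ j) + of_bool (i = j) * (\<i> * of_real (\<theta> * \<alpha> j)))))
      \<le> C * \<delta>\<^sup>2" for i j
    proof -
      define p q :: complex where "p = \<i> * of_real (\<theta> * \<alpha> j)" and "q = p - of_real L"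
      define a b :: complex where "a = of_bool (i = j) + of_real (?Q $ i $ j / L)"
        and "b = - of_real (?Q $ i $ j / L)"
      have eq: "of_real (P \<delta> $ i $ j) * exp (\<i> * of_real (\<theta> * \<delta> * \<alpha> j))
          = a * exp (p * of_real \<delta>) + b * exp (q * of_real \<delta>)" for \<delta>
      proof -
        have "exp (q * of_real \<delta>) = exp (p * of_real \<delta>) * of_real (exp (- L * \<delta>))"
          by (simp add: q_def exp_of_real[symmetric] exp_add[symmetric] algebra_simps)
        moreover have "exp (\<i> * of_real (\<theta> * \<delta> * \<alpha> j)) = exp (p * of_real \<delta>)"
          by (simp add: p_def mult_ac)
        moreover have "of_real (P \<delta> $ i $ j) = a + b * of_real (exp (- L * \<delta>))"
          using L by (simp add: P a_def b_def diff_divide_distrib left_diff_distrib algebra_simps)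
        ultimately show ?thesis
          by (simp add: algebra_simps)
      qed
      have d0: "a + b = of_bool (i = j)" by (simp add: a_def b_def)
      have d1: "a * p + b * q = of_real (?Q $ i $ j) + of_bool (i = j) * (\<i> * of_real (\<theta> * \<alpha> j))"
        using L by (simp add: a_def b_def q_def p_def field_simps)
      have e1: "((\<lambda>t. a * exp (p * of_real t) + b * exp (q * of_real t)) has_vector_derivative
          a * (p * exp (p * of_real t)) + b * (q * exp (q * of_real t))) (at t within {0..T})" for t
        by (intro has_vector_derivative_add has_vector_derivative_mult_right exp_of_real_has_vector_derivative)
      have e2: "((\<lambda>t. a * (p * exp (p * of_real t)) + b * (q * exp (q * of_real t))) has_vector_derivative
          a * (p * (p * exp (p * of_real t))) + b * (q * (q * exp (q * of_real t)))) (at t within {0..T})" for t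
        by (intro has_vector_derivative_add has_vector_derivative_mult_right exp_of_real_has_vector_derivative)
      have e3: "continuous_on {0..T} (\<lambda>t. a * (p * (p * exp (p * of_real t))) + b * (q * (q * exp (q * of_real t))))"
        by (intro continuous_intros)
      obtain C where C: "0 \<le> C" "\<And>s t. 0 \<le> s \<Longrightarrow> s \<le> t \<Longrightarrow> t \<le> T \<Longrightarrow>
        norm ((a * exp (p * of_real t) + b * exp (q * of_real t))
          - (a * exp (p * of_real s) + b * exp (q * of_real s))
          - (t - s) *\<^sub>R (a * (p * exp (p * of_real s)) + b * (q * exp (q * of_real s)))) \<le> C * (t - s)\<^sup>2"
        using second_order_remainder[OF e1 e2 e3] by blast
      show ?thesis
        using C(1) C(2)[of 0] unfolding eq d1[symmetric]
        by (intro exI[of _ C]) (simp add: d0 scaleR_conv_of_real algebra_simps)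
    qed
    then obtain C where C: "\<And>i j. 0 \<le> C i j" "\<And>i j \<delta>. 0 \<le> \<delta> \<Longrightarrow> \<delta> \<le> T \<Longrightarrow>
      norm (of_real (P \<delta> $ i $ j) * exp (\<i> * of_real (\<theta> * \<delta> * \<alpha> j))
        - (of_bool (i = j) + of_real \<delta> * (of_real (?Q $ i $ j) + of_bool (i = j) * (\<i> * of_real (\<theta> * \<alpha> j)))))
      \<le> C i j * \<delta>\<^sup>2"
      by metis
    have "C i j \<le> (\<Sum>i\<in>UNIV. \<Sum>j\<in>UNIV. C i j)" for i j
      using C(1) by (intro order_trans[OF member_le_sum[of j UNIV "C i"] member_le_sum[of i UNIV "\<lambda>i. \<Sum>j\<in>UNIV. C i j"]]) (auto intro: sum_nonneg)
    then show ?thesis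
      by (intro exI[of _ "\<Sum>i\<in>UNIV. \<Sum>j\<in>UNIV. C i j"] allI impI order_trans[OF C(2)] mult_right_mono) auto
  qed
qed

lemma matrix_steps_two_state_tendsto:
  fixes \<alpha> :: "2 \<Rightarrow> real" and \<theta> :: real
  assumes l: "l1 > 0" "l2 > 0" and T: "0 < T"
  defines "m \<equiv> (\<lambda>\<delta> i j. of_real (matrix_exp (\<delta> *\<^sub>R intensity_matrix l1 l2) $ i $ j) * exp (\<i> * of_real (\<theta> * \<delta> * \<alpha> j)))"
    and "m1 \<equiv> of_real l1 - \<i> * of_real (\<theta> * \<alpha> 1)" and "m2 \<equiv> of_real l2 - \<i> * of_real (\<theta> * \<alpha> 2)"
  shows "(\<lambda>n. matrix_steps (m (T / real n)) n 1 1) \<longlonglongrightarrow> return_char l1 l2 m1 m2 T"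
    and "(\<lambda>n. matrix_steps (m (T / real n)) n 1 2) \<longlonglongrightarrow> switch_char l1 l2 m1 m2 T"
proof -
  define v where "v j = (if j = 1 then return_char l1 l2 m1 m2 else switch_char l1 l2 m1 m2)" for j :: 2
  define A where "A i j = (of_real (intensity_matrix l1 l2 $ i $ j) + of_bool (i = j) * (\<i> * of_real (\<theta> * \<alpha> j)) :: complex)" for i j
  obtain C where C: "\<And>\<delta> i j. 0 \<le> \<delta> \<Longrightarrow> \<delta> \<le> T \<Longrightarrow> norm (m \<delta> i j - (of_bool (i = j) + of_real \<delta> * A i j)) \<le> C * \<delta>\<^sup>2"
    using two_state_step_expansion[OF l T, of \<theta> \<alpha>] unfolding m_def A_def by blast
  have lim: "(\<lambda>n. matrix_steps (m (T / real n)) n 1 j) \<longlonglongrightarrow> v j T" for j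
  proof (rule matrix_steps_tendsto[OF T, where A = A and C = C])
    show "v j 0 = of_bool (1 = j)" for j by (auto simp: v_def)
    show "(v j has_vector_derivative (\<Sum>i\<in>UNIV. v i t * A i j)) (at t within {0..T})" if "0 \<le> t" "t \<le> T" for j t
      using exhaust_2[of j] return_char_deriv[OF that, of l1 l2 m1 m2] switch_char_deriv[OF that, of l1 l2 m1 m2]
      by (auto simp: v_def A_def sum_2 m1_def m2_def algebra_simps)
    show "norm (m \<delta> i j - (of_bool (i = j) + of_real \<delta> * A i j)) \<le> C * \<delta>\<^sup>2" if "0 \<le> \<delta>" "\<delta> \<le> T" for \<delta> i j
      using C that by blast
    show "(\<Sum>j\<in>UNIV. norm (m \<delta> i j)) \<le> 1" if "0 \<le> \<delta>" "\<delta> \<le> T" for \<delta> i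
      using two_state_transition_rows[OF l T, of \<delta> i] two_state_transition_nonneg[OF l T that(1)]
      by (simp add: m_def norm_mult)
  qed
  from lim[of 1] lim[of 2] show
    "(\<lambda>n. matrix_steps (m (T / real n)) n 1 1) \<longlonglongrightarrow> return_char l1 l2 m1 m2 T"
    "(\<lambda>n. matrix_steps (m (T / real n)) n 1 2) \<longlonglongrightarrow> switch_char l1 l2 m1 m2 T"
    by (auto simp: v_def)
qed

section \<open>Multiplicative functionals of a Markov chain\<close>

lemma (in prob_space) markov_chain_measurable:
  "markov_chain Q X \<Longrightarrow> 0 \<le> t \<Longrightarrow> X t \<in> measurable M (count_space UNIV)"
  by (simp add: markov_chain_def)

lemma (in prob_space) markov_chain_past_measurable:
  fixes s :: "nat \<Rightarrow> real"
  assumes mc: "markov_chain Q X" and "0 \<le> t" "\<forall>k<n. 0 \<le> s k \<and> s k \<le> t"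
  shows "Measurable.pred M (\<lambda>\<omega>. X t \<omega> = i \<and> (\<forall>k<n. X (s k) \<omega> = x k))"
proof -
  have X: "Measurable.pred M (\<lambda>\<omega>. X u \<omega> = c)" if "0 \<le> u" for u c
    using markov_chain_measurable[OF mc that] by measurable
  have "Measurable.pred M (\<lambda>\<omega>. X t \<omega> = i \<and> (\<forall>k\<in>{..<n}. X (s k) \<omega> = x k))"
    using assms(2,3) by (intro pred_intros_logic pred_intros_finite X finite_lessThan) auto
  then show ?thesis by (simp add: Ball_def)
qed

text \<open>
  Stated as a product, the Markov property also holds when the past has probability \<open>0\<close>.
\<close>

lemma (in prob_space) markov_chain_step:
  fixes s :: "nat \<Rightarrow> real"
  assumes "markov_chain Q X" "0 \<le> t" "0 \<le> h" "\<forall>k<n. 0 \<le> s k \<and> s k \<le> t"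
  shows "\<P>(\<omega> in M. X (t + h) \<omega> = j \<and> X t \<omega> = i \<and> (\<forall>k<n. X (s k) \<omega> = x k))
    = matrix_exp (h *\<^sub>R Q) $ i $ j * \<P>(\<omega> in M. X t \<omega> = i \<and> (\<forall>k<n. X (s k) \<omega> = x k))"
proof (cases "\<P>(\<omega> in M. X t \<omega> = i \<and> (\<forall>k<n. X (s k) \<omega> = x k)) > 0")
  case True
  then have "\<P>(\<omega> in M. X (t + h) \<omega> = j \<bar> X t \<omega> = i \<and> (\<forall>k<n. X (s k) \<omega> = x k)) = matrix_exp (h *\<^sub>R Q) $ i $ j"
    using assms(1)[unfolded markov_chain_def, THEN conjunct2, THEN conjunct2, rule_format,
        of t h n s i x j] assms(2-4) by simp
  with True show ?thesis by (simp add: cond_prob_def divide_eq_eq)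
next
  case False
  then have *: "\<P>(\<omega> in M. X t \<omega> = i \<and> (\<forall>k<n. X (s k) \<omega> = x k)) = 0"
    using measure_nonneg[of M "{\<omega> \<in> space M. X t \<omega> = i \<and> (\<forall>k<n. X (s k) \<omega> = x k)}"] by linarith
  have "{\<omega> \<in> space M. X t \<omega> = i \<and> (\<forall>k<n. X (s k) \<omega> = x k)} \<in> events"
    using markov_chain_past_measurable[OF assms(1,2,4)] by measurable
  then have "\<P>(\<omega> in M. X (t + h) \<omega> = j \<and> X t \<omega> = i \<and> (\<forall>k<n. X (s k) \<omega> = x k))
      \<le> \<P>(\<omega> in M. X t \<omega> = i \<and> (\<forall>k<n. X (s k) \<omega> = x k))"
    by (intro finite_measure_mono) auto
  then show ?thesis using * by (simp add: measure_le_0_iff)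
qed

text \<open>
  The past \<open>s\<close>, \<open>x\<close> is arbitrary because the induction over the number of steps moves the
  present into the past: a step splits according to the next state \<open>l\<close>, with \<open>t\<close>, \<open>i\<close> appended
  to the past.
\<close>

lemma (in prob_space) markov_chain_multiplicative_functional:
  fixes X :: "real \<Rightarrow> 'a \<Rightarrow> 'n::finite" and g :: "'n \<Rightarrow> complex" and s :: "nat \<Rightarrow> real"
  assumes mc: "markov_chain Q X" and \<delta>: "0 \<le> \<delta>" and g: "\<And>l. norm (g l) \<le> 1"
  shows "0 \<le> t \<Longrightarrow> \<forall>k<n. 0 \<le> s k \<and> s k \<le> t \<Longrightarrow>
    (\<integral>\<omega>. of_bool (X t \<omega> = i \<and> (\<forall>k<n. X (s k) \<omega> = x k)) *
       ((\<Prod>m<r. g (X (t + real (Suc m) * \<delta>) \<omega>)) * of_bool (X (t + real r * \<delta>) \<omega> = j)) \<partial>M)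
    = of_real (\<P>(\<omega> in M. X t \<omega> = i \<and> (\<forall>k<n. X (s k) \<omega> = x k))) *
      matrix_steps (\<lambda>i j. of_real (matrix_exp (\<delta> *\<^sub>R Q) $ i $ j) * g j) r i j"
proof (induction r arbitrary: t n s x i)
  case 0
  have ev: "{\<omega> \<in> space M. X t \<omega> = i \<and> (\<forall>k<n. X (s k) \<omega> = x k)} \<in> events"
    using markov_chain_past_measurable[OF mc 0] by measurable
  have "(\<integral>\<omega>. of_bool (X t \<omega> = i \<and> (\<forall>k<n. X (s k) \<omega> = x k)) *
       ((\<Prod>m<0. g (X (t + real (Suc m) * \<delta>) \<omega>)) * of_bool (X (t + real 0 * \<delta>) \<omega> = j)) \<partial>M)
     = (\<integral>\<omega>. indicator {\<omega> \<in> space M. X t \<omega> = i \<and> (\<forall>k<n. X (s k) \<omega> = x k)} \<omega> *\<^sub>R of_bool (i = j) \<partial>M)"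
    by (intro Bochner_Integration.integral_cong) (auto simp: indicator_def)
  also have "\<dots> = of_real (\<P>(\<omega> in M. X t \<omega> = i \<and> (\<forall>k<n. X (s k) \<omega> = x k))) * of_bool (i = j)"
    using ev by (simp add: scaleR_conv_of_real)
  finally show ?case by simp
next
  case (Suc r)
  define s' where "s' = s(n := t)"
  define x' where "x' = x(n := i)"
  define E where "E l \<omega> \<longleftrightarrow> X (t + \<delta>) \<omega> = l \<and> (\<forall>k<Suc n. X (s' k) \<omega> = x' k)" for l \<omega>
  define G where "G \<omega> = (\<Prod>m<r. g (X ((t + \<delta>) + real (Suc m) * \<delta>) \<omega>)) * of_bool (X ((t + \<delta>) + real r * \<delta>) \<omega> = j)" for \<omega>
  have s': "\<forall>k<Suc n. 0 \<le> s' k \<and> s' k \<le> t + \<delta>"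
    using Suc.prems \<delta> by (auto simp: s'_def less_Suc_eq)
  have E_iff: "E l \<omega> \<longleftrightarrow> X (t + \<delta>) \<omega> = l \<and> X t \<omega> = i \<and> (\<forall>k<n. X (s k) \<omega> = x k)" for l \<omega>
    by (auto simp: E_def s'_def x'_def less_Suc_eq)
  have IH: "(\<integral>\<omega>. of_bool (E l \<omega>) * G \<omega> \<partial>M) = of_real (\<P>(\<omega> in M. E l \<omega>)) *
      matrix_steps (\<lambda>i j. of_real (matrix_exp (\<delta> *\<^sub>R Q) $ i $ j) * g j) r l j" for l
    unfolding E_def G_def using Suc.prems \<delta> by (intro Suc.IH s') auto
  have prob_E: "\<P>(\<omega> in M. E l \<omega>)
      = matrix_exp (\<delta> *\<^sub>R Q) $ i $ l * \<P>(\<omega> in M. X t \<omega> = i \<and> (\<forall>k<n. X (s k) \<omega> = x k))" for l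
    unfolding E_iff by (rule markov_chain_step[OF mc Suc.prems(1) \<delta> Suc.prems(2)])
  have XM: "(\<lambda>\<omega>. c (X u \<omega>)) \<in> borel_measurable M" if "0 \<le> u" for u and c :: "'n \<Rightarrow> complex"
    by (rule measurable_compose[OF markov_chain_measurable[OF mc that]]) simp
  have E_meas [measurable]: "Measurable.pred M (E l)" for l
    unfolding E_def[abs_def] using Suc.prems \<delta> by (intro markov_chain_past_measurable[OF mc _ s']) auto
  have [measurable]: "G \<in> borel_measurable M"
    unfolding G_def[abs_def] using Suc.prems \<delta>
    by (intro borel_measurable_times borel_measurable_prod XM[of _ g]
          XM[of _ "\<lambda>l. of_bool (l = j)"]) auto
  have norm_G: "norm (G \<omega>) \<le> 1" for \<omega>
    unfolding G_def norm_mult prod_norm[symmetric]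
    by (intro mult_le_one prod_le_1 conjI) (auto simp: g)
  have int: "integrable M (\<lambda>\<omega>. g l * (of_bool (E l \<omega>) * G \<omega>))" for l
    by (rule integrable_const_bound[where B = 1])
       (auto simp: norm_mult intro!: mult_le_one g norm_G)
  have "(\<integral>\<omega>. of_bool (X t \<omega> = i \<and> (\<forall>k<n. X (s k) \<omega> = x k)) *
       ((\<Prod>m<Suc r. g (X (t + real (Suc m) * \<delta>) \<omega>)) * of_bool (X (t + real (Suc r) * \<delta>) \<omega> = j)) \<partial>M)
     = (\<integral>\<omega>. (\<Sum>l\<in>UNIV. g l * (of_bool (E l \<omega>) * G \<omega>)) \<partial>M)"
  proof (rule Bochner_Integration.integral_cong[OF refl])
    fix \<omega>
    have "(\<Sum>l\<in>UNIV. g l * (of_bool (E l \<omega>) * G \<omega>))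
        = (\<Sum>l\<in>UNIV. if X (t + \<delta>) \<omega> = l then g l * (of_bool (X t \<omega> = i \<and> (\<forall>k<n. X (s k) \<omega> = x k)) * G \<omega>) else 0)"
      by (intro sum.cong) (auto simp: E_iff)
    also have "\<dots> = of_bool (X t \<omega> = i \<and> (\<forall>k<n. X (s k) \<omega> = x k)) * (g (X (t + \<delta>) \<omega>) * G \<omega>)"
      by simp
    also have "g (X (t + \<delta>) \<omega>) * G \<omega>
        = (\<Prod>m<Suc r. g (X (t + real (Suc m) * \<delta>) \<omega>)) * of_bool (X (t + real (Suc r) * \<delta>) \<omega> = j)"
      unfolding prod.lessThan_Suc_shift G_def by (simp add: algebra_simps)
    finally show "of_bool (X t \<omega> = i \<and> (\<forall>k<n. X (s k) \<omega> = x k)) *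
       ((\<Prod>m<Suc r. g (X (t + real (Suc m) * \<delta>) \<omega>)) * of_bool (X (t + real (Suc r) * \<delta>) \<omega> = j))
       = (\<Sum>l\<in>UNIV. g l * (of_bool (E l \<omega>) * G \<omega>))" ..
  qed
  also have "\<dots> = (\<Sum>l\<in>UNIV. g l * (\<integral>\<omega>. of_bool (E l \<omega>) * G \<omega> \<partial>M))"
    using int by simp
  also have "\<dots> = (\<Sum>l\<in>UNIV. g l * (of_real (matrix_exp (\<delta> *\<^sub>R Q) $ i $ l * \<P>(\<omega> in M. X t \<omega> = i \<and> (\<forall>k<n. X (s k) \<omega> = x k)))
      * matrix_steps (\<lambda>i j. of_real (matrix_exp (\<delta> *\<^sub>R Q) $ i $ j) * g j) r l j))"
    by (simp only: IH prob_E)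
  finally show ?case
    by (simp only: matrix_steps.simps sum_distrib_left of_real_mult mult_ac)
qed

section \<open>Riemann sums along a path\<close>

text \<open>
  Each grid interval is represented by its right endpoint. For fixed \<open>s\<close> these endpoints tend to
  \<open>s\<close> strictly from the right, so the path eventually takes there its value at \<open>s\<close>. This makes
  the convergence pointwise, with no count of the jumps; the path is measurable as the limit of
  step functions.
\<close>

lemma right_constant_riemann_sums:
  fixes y :: "real \<Rightarrow> 'n::finite" and f :: "'n \<Rightarrow> real"
  assumes T: "0 < T" and y: "\<And>t. 0 \<le> t \<Longrightarrow> \<forall>\<^sub>F s in at_right t. y s = y t"
  shows "(\<lambda>n. (\<Sum>m<n. f (y (real (Suc m) * (T / real n)))) * (T / real n)) \<longlonglongrightarrow> (LBINT s:{0..T}. f (y s))"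
proof -
  define \<phi> where "\<phi> n s = (\<Sum>m<n. f (y (real (Suc m) * (T / real n))) *
      indicator {real m * (T / real n)..<real (Suc m) * (T / real n)} s)" for n and s :: real
  define B where "B = (\<Sum>l\<in>UNIV. \<bar>f l\<bar>)"
  have B: "\<bar>f l\<bar> \<le> B" for l unfolding B_def by (rule member_le_sum) auto
  have \<phi>_eq: "\<phi> n s = indicator {0..<T} s * f (y (real (Suc (nat \<lfloor>s / (T / real n)\<rfloor>)) * (T / real n)))"
    if n: "0 < n" for n s
  proof -
    define d where "d = T / real n"
    have d: "0 < d" "real n * d = T" using n T by (auto simp: d_def)
    have iff: "s \<in> {real m * d..<real (Suc m) * d} \<longleftrightarrow> 0 \<le> s \<and> m = nat \<lfloor>s / d\<rfloor>" for m
    proof -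
      have "s \<in> {real m * d..<real (Suc m) * d} \<longleftrightarrow> \<lfloor>s / d\<rfloor> = int m"
        using d by (simp add: floor_eq_iff field_simps)
      also have "\<dots> \<longleftrightarrow> 0 \<le> s \<and> m = nat \<lfloor>s / d\<rfloor>"
      proof (cases "0 \<le> s")
        case True
        then show ?thesis using d by auto
      next
        case False
        then have "s / d < 0" using d by (simp add: divide_neg_pos)
        then have "\<lfloor>s / d\<rfloor> < 0" by (simp only: floor_less_zero)
        then have "\<lfloor>s / d\<rfloor> \<noteq> int m" by linarith
        then show ?thesis using False by simp
      qed
      finally show ?thesis .
    qed
    have "\<phi> n s = (\<Sum>m<n. if m = nat \<lfloor>s / d\<rfloor> then of_bool (0 \<le> s) * f (y (real (Suc m) * d)) else 0)"
      unfolding \<phi>_def d_def[symmetric] indicator_def iff by (intro sum.cong) auto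
    also have "\<dots> = (if nat \<lfloor>s / d\<rfloor> < n then of_bool (0 \<le> s) * f (y (real (Suc (nat \<lfloor>s / d\<rfloor>)) * d)) else 0)"
      by simp
    also have "\<dots> = of_bool (0 \<le> s \<and> nat \<lfloor>s / d\<rfloor> < n) * f (y (real (Suc (nat \<lfloor>s / d\<rfloor>)) * d))"
      by simp
    also have "0 \<le> s \<and> nat \<lfloor>s / d\<rfloor> < n \<longleftrightarrow> s \<in> {0..<T}"
    proof (cases "0 \<le> s")
      case True
      have "nat \<lfloor>s / d\<rfloor> < n \<longleftrightarrow> \<lfloor>s / d\<rfloor> < int n" using n by linarith
      also have "\<dots> \<longleftrightarrow> s / d < real n" by (simp add: floor_less_iff)
      also have "\<dots> \<longleftrightarrow> s < T" using d by (simp add: divide_less_eq)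
      finally show ?thesis using True by simp
    qed auto
    finally show ?thesis by (simp add: indicator_def d_def)
  qed
  have lim: "(\<lambda>n. \<phi> n s) \<longlonglongrightarrow> indicator {0..<T} s * f (y s)" for s
  proof (cases "s \<in> {0..<T}")
    case True
    obtain b where b: "s < b" "\<And>u. s < u \<Longrightarrow> u < b \<Longrightarrow> y u = y s"
      using y[of s] True by (auto simp: eventually_at_right_field)
    have "(\<lambda>n. T / real n) \<longlonglongrightarrow> 0" by (rule lim_const_over_n)
    then have "\<forall>\<^sub>F n in sequentially. T / real n < b - s"
      by (rule order_tendstoD) (use b in simp)
    with eventually_gt_at_top[of 0] have "\<forall>\<^sub>F n in sequentially. \<phi> n s = indicator {0..<T} s * f (y s)"
    proof eventually_elim
      case (elim n)
      define d where "d = T / real n"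
      have d: "0 < d" "d < b - s" using elim T by (auto simp: d_def)
      have nn: "0 \<le> \<lfloor>s / d\<rfloor>" using d True by simp
      have "real_of_int \<lfloor>s / d\<rfloor> * d \<le> s" "s < real_of_int \<lfloor>s / d\<rfloor> * d + d"
        using floor_divide_lower[OF d(1), of s] floor_divide_upper[OF d(1), of s]
        by (simp_all add: distrib_right)
      moreover have "real (Suc (nat \<lfloor>s / d\<rfloor>)) * d = real_of_int \<lfloor>s / d\<rfloor> * d + d"
        using nn by (simp add: algebra_simps)
      ultimately have "s < real (Suc (nat \<lfloor>s / d\<rfloor>)) * d" "real (Suc (nat \<lfloor>s / d\<rfloor>)) * d < b"
        using d by linarith+
      then have "y (real (Suc (nat \<lfloor>s / d\<rfloor>)) * d) = y s" by (intro b)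
      then show ?case using \<phi>_eq[OF elim(1)] by (simp add: d_def)
    qed
    then show ?thesis by (rule tendsto_eventually)
  next
    case False
    have "\<forall>\<^sub>F n in sequentially. \<phi> n s = indicator {0..<T} s * f (y s)"
      using eventually_gt_at_top[of 0] by eventually_elim (use \<phi>_eq False in auto)
    then show ?thesis by (rule tendsto_eventually)
  qed
  have meas: "\<phi> n \<in> borel_measurable lborel" for n
    unfolding \<phi>_def[abs_def] by measurable
  have int_\<phi>: "(LBINT s. \<phi> n s) = (\<Sum>m<n. f (y (real (Suc m) * (T / real n)))) * (T / real n)" for n
  proof -
    define d where "d = T / real n"
    have "0 \<le> d" using T by (simp add: d_def)
    then have le: "real m * d \<le> real (Suc m) * d" for m by (intro mult_right_mono) auto
    have meas_I: "measure lborel {real m * d..<real (Suc m) * d} = d" for m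
      using measure_lborel_Ico[OF le[of m]] by (simp add: algebra_simps)
    have int_I: "integrable lborel (indicator {real m * d..<real (Suc m) * d} :: real \<Rightarrow> real)" for m
      by (rule integrable_real_indicator) (simp, subst emeasure_lborel_Ico[OF le], simp)
    have "(LBINT s. \<phi> n s) = (\<Sum>m<n. LBINT s. f (y (real (Suc m) * d)) * indicator {real m * d..<real (Suc m) * d} s)"
      unfolding \<phi>_def d_def[symmetric]
      by (intro Bochner_Integration.integral_sum integrable_mult_right int_I)
    also have "\<dots> = (\<Sum>m<n. f (y (real (Suc m) * d)) * d)"
      by (intro sum.cong refl) (simp add: meas_I del: of_nat_Suc)
    finally show ?thesis by (simp only: sum_distrib_right d_def)
  qed
  have "(\<lambda>n. LBINT s. \<phi> n s) \<longlonglongrightarrow> (LBINT s. indicator {0..<T} s * f (y s))"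
  proof (rule integral_dominated_convergence[where w = "\<lambda>s. indicator {0..<T} s * B"])
    show "(\<lambda>s. indicator {0..<T} s * f (y s)) \<in> borel_measurable lborel"
      by (rule borel_measurable_LIMSEQ_real[OF lim meas])
    show "integrable lborel (\<lambda>s. indicator {0..<T} s * B)"
      using T by (intro integrable_mult_left integrable_real_indicator) auto
    show "AE s in lborel. (\<lambda>n. \<phi> n s) \<longlonglongrightarrow> indicator {0..<T} s * f (y s)"
      using lim by simp
    show "\<phi> n \<in> borel_measurable lborel" for n
      by (rule meas)
    show "AE s in lborel. norm (\<phi> n s) \<le> indicator {0..<T} s * B" for n
    proof (cases "n = 0")
      case True
      have "0 \<le> B" unfolding B_def by (simp add: sum_nonneg)
      then show ?thesis using True by (simp add: \<phi>_def)
    next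
      case False
      have "norm (\<phi> n s) \<le> indicator {0..<T} s * B" for s
        using False B by (auto simp: \<phi>_eq indicator_def)
      then show ?thesis by simp
    qed
  qed
  \<comment> \<open>The steps cover \<open>{0..<T}\<close>; the missing point \<open>T\<close> has measure zero.\<close>
  also have "(LBINT s. indicator {0..<T} s * f (y s)) = (LBINT s:{0..T}. f (y s))"
    unfolding set_lebesgue_integral_def
  proof (rule integral_cong_AE)
    have m: "(\<lambda>s. indicator {0..<T} s * f (y s)) \<in> borel_measurable lborel"
      by (rule borel_measurable_LIMSEQ_real[OF lim meas])
    then show "(\<lambda>s. indicator {0..<T} s * f (y s)) \<in> borel_measurable lborel" .
    have "(\<lambda>s. indicator {0..<T} s * f (y s) + indicator {T} s * f (y T)) \<in> borel_measurable lborel"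
      by (intro borel_measurable_add m) measurable
    also have "(\<lambda>s. indicator {0..<T} s * f (y s) + indicator {T} s * f (y T)) = (\<lambda>s. indicator {0..T} s *\<^sub>R f (y s))"
      using T by (auto simp: fun_eq_iff indicator_def)
    finally show "(\<lambda>s. indicator {0..T} s *\<^sub>R f (y s)) \<in> borel_measurable lborel" .
    show "AE s in lborel. indicator {0..<T} s * f (y s) = indicator {0..T} s *\<^sub>R f (y s)"
      using AE_lborel_singleton[of T] by eventually_elim (auto simp: indicator_def)
  qed
  finally show ?thesis by (simp only: int_\<phi>)
qed

section \<open>The Fourier transform of drift plus noise\<close>

lemma (in prob_space) indep_set_mono:
  assumes "indep_set P Q" "A \<subseteq> P" "B \<subseteq> Q"
  shows "indep_set A B"
proof -
  have "P \<subseteq> events" "Q \<subseteq> events" "\<And>a b. a \<in> P \<Longrightarrow> b \<in> Q \<Longrightarrow> prob (a \<inter> b) = prob a * prob b"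
    using assms(1) by (auto simp: indep_sets2_eq)
  with assms(2,3) show ?thesis
    unfolding indep_sets2_eq by (meson subsetD subset_trans)
qed

text \<open>
  The preimages under a measurable functional of a process are events of the process, so
  independence passes to functionals of the two whole paths.
\<close>

lemma (in prob_space) indep_processes_indep_var:
  fixes u :: "(real \<Rightarrow> 'b) \<Rightarrow> 'd::{second_countable_topology}" and v :: "(real \<Rightarrow> 'c) \<Rightarrow> 'd"
  assumes ind: "indep_processes S X T Y"
    and X: "\<And>t. 0 \<le> t \<Longrightarrow> X t \<in> measurable M S" and Y: "\<And>t. 0 \<le> t \<Longrightarrow> Y t \<in> measurable M T"
    and u: "u \<in> borel_measurable (Pi\<^sub>M {0..} (\<lambda>_. S))" and v: "v \<in> borel_measurable (Pi\<^sub>M {0..} (\<lambda>_. T))"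
  shows "indep_var borel (\<lambda>\<omega>. u (\<lambda>t\<in>{0..}. X t \<omega>)) borel (\<lambda>\<omega>. v (\<lambda>t\<in>{0..}. Y t \<omega>))"
proof -
  have X': "(\<lambda>\<omega>. \<lambda>t\<in>{0..}. X t \<omega>) \<in> measurable M (Pi\<^sub>M {0..} (\<lambda>_. S))"
    by (intro measurable_restrict X) auto
  have Y': "(\<lambda>\<omega>. \<lambda>t\<in>{0..}. Y t \<omega>) \<in> measurable M (Pi\<^sub>M {0..} (\<lambda>_. T))"
    by (intro measurable_restrict Y) auto
  let ?A = "{(\<lambda>\<omega>. u (\<lambda>t\<in>{0..}. X t \<omega>)) -` A \<inter> space M | A. A \<in> sets borel}"
  let ?B = "{(\<lambda>\<omega>. v (\<lambda>t\<in>{0..}. Y t \<omega>)) -` A \<inter> space M | A. A \<in> sets borel}"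
  have A: "?A \<subseteq> {(\<lambda>\<omega>. \<lambda>t\<in>{0..}. X t \<omega>) -` A \<inter> space M | A. A \<in> sets (Pi\<^sub>M {0..} (\<lambda>_. S))}"
  proof safe
    fix A :: "'d set" assume "A \<in> sets borel"
    then have "u -` A \<inter> space (Pi\<^sub>M {0..} (\<lambda>_. S)) \<in> sets (Pi\<^sub>M {0..} (\<lambda>_. S))"
      by (rule measurable_sets[OF u])
    moreover have "(\<lambda>\<omega>. u (\<lambda>t\<in>{0..}. X t \<omega>)) -` A \<inter> space M
        = (\<lambda>\<omega>. \<lambda>t\<in>{0..}. X t \<omega>) -` (u -` A \<inter> space (Pi\<^sub>M {0..} (\<lambda>_. S))) \<inter> space M"
      using measurable_space[OF X'] by auto
    ultimately show "\<exists>B. (\<lambda>\<omega>. u (\<lambda>t\<in>{0..}. X t \<omega>)) -` A \<inter> space M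
        = (\<lambda>\<omega>. \<lambda>t\<in>{0..}. X t \<omega>) -` B \<inter> space M \<and> B \<in> sets (Pi\<^sub>M {0..} (\<lambda>_. S))" by blast
  qed
  have B: "?B \<subseteq> {(\<lambda>\<omega>. \<lambda>t\<in>{0..}. Y t \<omega>) -` A \<inter> space M | A. A \<in> sets (Pi\<^sub>M {0..} (\<lambda>_. T))}"
  proof safe
    fix A :: "'d set" assume "A \<in> sets borel"
    then have "v -` A \<inter> space (Pi\<^sub>M {0..} (\<lambda>_. T)) \<in> sets (Pi\<^sub>M {0..} (\<lambda>_. T))"
      by (rule measurable_sets[OF v])
    moreover have "(\<lambda>\<omega>. v (\<lambda>t\<in>{0..}. Y t \<omega>)) -` A \<inter> space M
        = (\<lambda>\<omega>. \<lambda>t\<in>{0..}. Y t \<omega>) -` (v -` A \<inter> space (Pi\<^sub>M {0..} (\<lambda>_. T))) \<inter> space M"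
      using measurable_space[OF Y'] by auto
    ultimately show "\<exists>B. (\<lambda>\<omega>. v (\<lambda>t\<in>{0..}. Y t \<omega>)) -` A \<inter> space M
        = (\<lambda>\<omega>. \<lambda>t\<in>{0..}. Y t \<omega>) -` B \<inter> space M \<and> B \<in> sets (Pi\<^sub>M {0..} (\<lambda>_. T))" by blast
  qed
  have "indep_set ?A ?B"
    using indep_set_mono[OF ind[unfolded indep_processes_def] A B] .
  moreover have "Int_stable {f -` A \<inter> space M | A. A \<in> sets borel}" for f :: "'a \<Rightarrow> 'd"
  proof (rule Int_stableI, safe)
    fix A B :: "'d set" assume "A \<in> sets borel" "B \<in> sets borel"
    then show "\<exists>C. (f -` A \<inter> space M) \<inter> (f -` B \<inter> space M) = f -` C \<inter> space M \<and> C \<in> sets borel"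
      by (intro exI[of _ "A \<inter> B"]) auto
  qed
  ultimately have "indep_set (sigma_sets (space M) ?A) (sigma_sets (space M) ?B)"
    by (intro indep_set_sigma_sets)
  then show ?thesis
    using measurable_compose[OF X' u] measurable_compose[OF Y' v] by (simp add: indep_var_eq)
qed

lemma integral_iexp_normal_density:
  assumes s: "0 < s"
  shows "(\<integral>x. normal_density m s x *\<^sub>R exp (\<i> * of_real (\<theta> * x)) \<partial>lborel)
      = exp (\<i> * of_real (\<theta> * m)) * of_real (exp (- (s * \<theta>)\<^sup>2 / 2))"
proof -
  have "(\<integral>x. normal_density m s x *\<^sub>R exp (\<i> * of_real (\<theta> * x)) \<partial>lborel)
     = \<bar>s\<bar> *\<^sub>R (\<integral>x. normal_density m s (m + s * x) *\<^sub>R exp (\<i> * of_real (\<theta> * (m + s * x))) \<partial>lborel)"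
    using s by (intro lborel_integral_real_affine) simp
  also have "\<dots> = (\<integral>x. exp (\<i> * of_real (\<theta> * m)) * (std_normal_density x *\<^sub>R exp (\<i> * of_real (s * \<theta> * x))) \<partial>lborel)"
    unfolding integral_scaleR_right[symmetric]
  proof (rule Bochner_Integration.integral_cong[OF refl])
    fix x
    have "\<bar>s\<bar> * normal_density m s (m + s * x) = std_normal_density x"
      using s by (simp add: normal_density_def real_sqrt_mult power_mult_distrib field_simps)
    then show "\<bar>s\<bar> *\<^sub>R (normal_density m s (m + s * x) *\<^sub>R exp (\<i> * of_real (\<theta> * (m + s * x))))
       = exp (\<i> * of_real (\<theta> * m)) * (std_normal_density x *\<^sub>R exp (\<i> * of_real (s * \<theta> * x)))"
      by (simp add: exp_add[symmetric] algebra_simps)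
  qed
  also have "\<dots> = exp (\<i> * of_real (\<theta> * m)) * char std_normal_distribution (s * \<theta>)"
  proof -
    have "char std_normal_distribution (s * \<theta>) = (\<integral>x. std_normal_density x *\<^sub>R exp (\<i> * of_real (s * \<theta> * x)) \<partial>lborel)"
      unfolding char_def by (rule integral_density) auto
    then show ?thesis by (simp only: integral_mult_right_zero)
  qed
  finally show ?thesis by (simp add: char_std_normal_distribution)
qed

lemma (in prob_space) standard_brownian_motion_char:
  assumes bm: "standard_brownian_motion W" and h: "0 < h"
  shows "(\<integral>\<omega>. exp (\<i> * of_real (\<theta> * W h \<omega>)) \<partial>M) = of_real (exp (- (sqrt h * \<theta>)\<^sup>2 / 2))"
proof -
  have [measurable]: "W h \<in> borel_measurable M" "W 0 \<in> borel_measurable M"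
    using bm h by (auto simp: standard_brownian_motion_def)
  have 0: "AE \<omega> in M. W 0 \<omega> = 0"
    and d: "distributed M lborel (\<lambda>\<omega>. W h \<omega> - W 0 \<omega>) (normal_density 0 (sqrt (h - 0)))"
    using bm h unfolding standard_brownian_motion_def by auto
  have "(\<integral>\<omega>. exp (\<i> * of_real (\<theta> * W h \<omega>)) \<partial>M) = (\<integral>\<omega>. exp (\<i> * of_real (\<theta> * (W h \<omega> - W 0 \<omega>))) \<partial>M)"
    using 0 by (intro integral_cong_AE) auto
  also have "\<dots> = (\<integral>x. normal_density 0 (sqrt (h - 0)) x *\<^sub>R exp (\<i> * of_real (\<theta> * x)) \<partial>lborel)"
  proof -
    have "(\<integral>\<omega>. exp (\<i> * of_real (\<theta> * (W h \<omega> - W 0 \<omega>))) \<partial>M)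
        = (\<integral>x. exp (\<i> * of_real (\<theta> * x)) \<partial>distr M lborel (\<lambda>\<omega>. W h \<omega> - W 0 \<omega>))"
      by (rule integral_distr[symmetric]) auto
    also have "distr M lborel (\<lambda>\<omega>. W h \<omega> - W 0 \<omega>) = density lborel (normal_density 0 (sqrt (h - 0)))"
      by (rule distributed_distr_eq_density[OF d])
    finally show ?thesis by (subst (asm) integral_density) auto
  qed
  also have "\<dots> = of_real (exp (- (sqrt h * \<theta>)\<^sup>2 / 2))"
    using h by (subst integral_iexp_normal_density) auto
  finally show ?thesis .
qed

context prob_space
begin

context
  fixes l1 l2 \<sigma> h :: real and \<epsilon> :: "real \<Rightarrow> 'a \<Rightarrow> 2" and W :: "real \<Rightarrow> 'a \<Rightarrow> real" and \<alpha> :: "2 \<Rightarrow> real"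
  assumes l: "l1 > 0" "l2 > 0" and h: "h > 0"
    and mc: "markov_chain (intensity_matrix l1 l2) \<epsilon>"
    and bm: "standard_brownian_motion W"
    and ind: "indep_processes (count_space UNIV) \<epsilon> borel W"
begin

lemma riemann_sums_tendsto_drift:
  assumes "\<omega> \<in> space M"
  shows "(\<lambda>n. (\<Sum>m<n. \<alpha> (\<epsilon> (real (Suc m) * (h / real n)) \<omega>)) * (h / real n)) \<longlonglongrightarrow> (LBINT s:{0..h}. \<alpha> (\<epsilon> s \<omega>))"
  using mc assms by (intro right_constant_riemann_sums h) (auto simp: markov_chain_def)

lemma chain_borel: "0 \<le> t \<Longrightarrow> (\<lambda>\<omega>. (f (\<epsilon> t \<omega>)::'c::topological_space)) \<in> borel_measurable M"
  by (rule measurable_compose[OF markov_chain_measurable[OF mc]]) auto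

lemma drift_borel [measurable]: "(\<lambda>\<omega>. LBINT s:{0..h}. \<alpha> (\<epsilon> s \<omega>)) \<in> borel_measurable M"
proof (rule borel_measurable_LIMSEQ_real[OF riemann_sums_tendsto_drift])
  show "(\<lambda>\<omega>. (\<Sum>m<n. \<alpha> (\<epsilon> (real (Suc m) * (h / real n)) \<omega>)) * (h / real n)) \<in> borel_measurable M" for n
    using h by (intro borel_measurable_times borel_measurable_sum chain_borel borel_measurable_const) simp
qed

text \<open>
  On a grid the drift is a functional of finitely many values of the chain. There independence
  splits off the Gaussian factor and the Markov property turns the expectation into a matrix
  power. Both sides pass to the limit, the expectation by dominated convergence since everything
  has modulus at most \<open>1\<close>.
\<close>

lemma char_drift_plus_noise:
  fixes j :: 2 and \<theta> :: real
  assumes lim: "(\<lambda>n. matrix_steps (\<lambda>i j. of_real (matrix_exp ((h / real n) *\<^sub>R intensity_matrix l1 l2) $ i $ j) *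
      exp (\<i> * of_real (\<theta> * (h / real n) * \<alpha> j))) n 1 j) \<longlonglongrightarrow> v"
  shows "(\<integral>\<omega>. of_bool (\<epsilon> 0 \<omega> = 1 \<and> \<epsilon> h \<omega> = j) * exp (\<i> * of_real (\<theta> * ((LBINT s:{0..h}. \<alpha> (\<epsilon> s \<omega>)) + \<sigma> * W h \<omega>))) \<partial>M)
    = of_real (\<P>(\<omega> in M. \<epsilon> 0 \<omega> = 1)) * v * of_real (exp (- (\<sigma> * sqrt h * \<theta>)\<^sup>2 / 2))"
proof -
  define S where "S \<omega> = (LBINT s:{0..h}. \<alpha> (\<epsilon> s \<omega>))" for \<omega>
  define V where "V \<omega> = exp (\<i> * of_real (\<theta> * \<sigma> * W h \<omega>))" for \<omega>
  define u where "u n x = of_bool (x 0 = 1) * ((\<Prod>m<n. exp (\<i> * of_real (\<theta> * (h / real n) * \<alpha> (x (0 + real (Suc m) * (h / real n))))))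
      * (of_bool (x (0 + real n * (h / real n)) = j) :: complex))" for n and x :: "real \<Rightarrow> 2"
  have Wm [measurable]: "W t \<in> borel_measurable M" if "0 \<le> t" for t
    using bm that by (simp add: standard_brownian_motion_def)
  have [measurable]: "W h \<in> borel_measurable M" using h by simp
  have [measurable]: "S \<in> borel_measurable M" unfolding S_def[abs_def] by measurable
  have norm_u: "norm (u n x) \<le> 1" for n x
    unfolding u_def norm_mult prod_norm[symmetric]
    by (intro mult_le_one prod_le_1 conjI) auto
  have comp: "(\<lambda>x. f (x t)) \<in> borel_measurable (Pi\<^sub>M {0..} (\<lambda>_. count_space UNIV))" if "0 \<le> t"
    for t :: real and f :: "2 \<Rightarrow> complex"
    by (rule measurable_compose[OF measurable_component_singleton]) (use that in auto)
  have u: "u n \<in> borel_measurable (Pi\<^sub>M {0..} (\<lambda>_. count_space UNIV))" for n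
    unfolding u_def[abs_def] using h
    by (intro borel_measurable_times borel_measurable_prod comp[of _ "\<lambda>x. of_bool (x = _)"]
        comp[of _ "\<lambda>x. exp (\<i> * of_real (\<theta> * (h / real n) * \<alpha> x))"]) auto
  define U where "U n \<omega> = u n (\<lambda>t\<in>{0..}. \<epsilon> t \<omega>)" for n \<omega>
  have U: "U n \<omega> = of_bool (\<epsilon> 0 \<omega> = 1) * ((\<Prod>m<n. exp (\<i> * of_real (\<theta> * (h / real n) * \<alpha> (\<epsilon> (0 + real (Suc m) * (h / real n)) \<omega>))))
      * of_bool (\<epsilon> (0 + real n * (h / real n)) \<omega> = j))" for n \<omega>
    using h by (simp add: U_def u_def)
  have v: "(\<lambda>y. exp (\<i> * of_real (\<theta> * \<sigma> * y h))) \<in> borel_measurable (Pi\<^sub>M {0..} (\<lambda>_. borel))"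
    by (rule measurable_compose[OF measurable_component_singleton]) (use h in auto)
  have iv: "indep_var borel (U n) borel V" for n
    using indep_processes_indep_var[OF ind markov_chain_measurable[OF mc] Wm u v] h
    by (simp add: U_def[abs_def] V_def[abs_def])
  have [measurable]: "U n \<in> borel_measurable M" "V \<in> borel_measurable M" for n
    using iv indep_var_rv1 indep_var_rv2 by blast+
  have norm_U: "norm (U n \<omega>) \<le> 1" and norm_V: "norm (V \<omega>) = 1" for n \<omega>
    unfolding U_def V_def using norm_u by auto
  have EU: "(\<integral>\<omega>. U n \<omega> \<partial>M) = of_real (\<P>(\<omega> in M. \<epsilon> 0 \<omega> = 1)) *
     matrix_steps (\<lambda>i j. of_real (matrix_exp ((h / real n) *\<^sub>R intensity_matrix l1 l2) $ i $ j) *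
      exp (\<i> * of_real (\<theta> * (h / real n) * \<alpha> j))) n 1 j" for n
    using markov_chain_multiplicative_functional[OF mc, of "h / real n"
        "\<lambda>l. exp (\<i> * of_real (\<theta> * (h / real n) * \<alpha> l))" 0 0 _ 1 _ n j] h
    unfolding U by simp
  have EV: "(\<integral>\<omega>. V \<omega> \<partial>M) = of_real (exp (- (\<sigma> * sqrt h * \<theta>)\<^sup>2 / 2))"
    using standard_brownian_motion_char[OF bm h, of "\<theta> * \<sigma>"] by (simp add: V_def mult_ac)
  have "(\<integral>\<omega>. U n \<omega> * V \<omega> \<partial>M) = (\<integral>\<omega>. U n \<omega> \<partial>M) * (\<integral>\<omega>. V \<omega> \<partial>M)" for n
    using norm_U norm_V
    by (intro indep_var_lebesgue_integral iv integrable_const_bound[where B = 1]) auto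
  then have "(\<lambda>n. \<integral>\<omega>. U n \<omega> * V \<omega> \<partial>M) \<longlonglongrightarrow>
     of_real (\<P>(\<omega> in M. \<epsilon> 0 \<omega> = 1)) * v * of_real (exp (- (\<sigma> * sqrt h * \<theta>)\<^sup>2 / 2))"
    by (simp only: EU EV) (intro tendsto_mult tendsto_const lim)
  moreover have "(\<lambda>n. \<integral>\<omega>. U n \<omega> * V \<omega> \<partial>M) \<longlonglongrightarrow>
     (\<integral>\<omega>. of_bool (\<epsilon> 0 \<omega> = 1 \<and> \<epsilon> h \<omega> = j) * exp (\<i> * of_real (\<theta> * (S \<omega> + \<sigma> * W h \<omega>))) \<partial>M)"
  proof (rule integral_dominated_convergence[where w = "\<lambda>_. 1"])
    have [measurable]: "\<epsilon> 0 \<in> measurable M (count_space UNIV)" "\<epsilon> h \<in> measurable M (count_space UNIV)"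
      using markov_chain_measurable[OF mc] h by auto
    have [measurable]: "Measurable.pred M (\<lambda>\<omega>. \<epsilon> 0 \<omega> = 1 \<and> \<epsilon> h \<omega> = j)"
      by measurable
    show "(\<lambda>\<omega>. of_bool (\<epsilon> 0 \<omega> = 1 \<and> \<epsilon> h \<omega> = j) * exp (\<i> * of_real (\<theta> * (S \<omega> + \<sigma> * W h \<omega>)))) \<in> borel_measurable M"
      by measurable
    show "AE \<omega> in M. norm (U n \<omega> * V \<omega>) \<le> 1" for n
      using norm_U norm_V by (simp add: norm_mult)
    show "AE \<omega> in M. (\<lambda>n. U n \<omega> * V \<omega>) \<longlonglongrightarrow>
       of_bool (\<epsilon> 0 \<omega> = 1 \<and> \<epsilon> h \<omega> = j) * exp (\<i> * of_real (\<theta> * (S \<omega> + \<sigma> * W h \<omega>)))"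
    proof (rule AE_I2)
      fix \<omega> assume \<omega>: "\<omega> \<in> space M"
      define R where "R n = (\<Sum>m<n. \<alpha> (\<epsilon> (real (Suc m) * (h / real n)) \<omega>)) * (h / real n)" for n
      have "R \<longlonglongrightarrow> S \<omega>"
        unfolding R_def[abs_def] S_def by (rule riemann_sums_tendsto_drift[OF \<omega>])
      then have "(\<lambda>n. of_bool (\<epsilon> 0 \<omega> = 1 \<and> \<epsilon> h \<omega> = j) * exp (\<i> * of_real (\<theta> * R n)) * V \<omega>)
        \<longlonglongrightarrow> of_bool (\<epsilon> 0 \<omega> = 1 \<and> \<epsilon> h \<omega> = j) * exp (\<i> * of_real (\<theta> * S \<omega>)) * V \<omega>"
        by (intro tendsto_intros)
      moreover have "\<forall>\<^sub>F n in sequentially.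
         of_bool (\<epsilon> 0 \<omega> = 1 \<and> \<epsilon> h \<omega> = j) * exp (\<i> * of_real (\<theta> * R n)) * V \<omega> = U n \<omega> * V \<omega>"
        using eventually_gt_at_top[of 0]
      proof eventually_elim
        case (elim n)
        have "(\<Prod>m<n. exp (\<i> * of_real (\<theta> * (h / real n) * \<alpha> (\<epsilon> (real (Suc m) * (h / real n)) \<omega>))))
           = exp (\<Sum>m<n. \<i> * of_real (\<theta> * (h / real n) * \<alpha> (\<epsilon> (real (Suc m) * (h / real n)) \<omega>)))"
          by (rule exp_sum[symmetric]) simp
        also have "(\<Sum>m<n. \<i> * of_real (\<theta> * (h / real n) * \<alpha> (\<epsilon> (real (Suc m) * (h / real n)) \<omega>)))
           = \<i> * of_real (\<theta> * R n)"
          unfolding R_def by (simp only: of_real_mult of_real_sum sum_distrib_left sum_distrib_right mult_ac)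
        finally show ?case
          using elim unfolding U by simp
      qed
      ultimately have "(\<lambda>n. U n \<omega> * V \<omega>) \<longlonglongrightarrow> of_bool (\<epsilon> 0 \<omega> = 1 \<and> \<epsilon> h \<omega> = j) * exp (\<i> * of_real (\<theta> * S \<omega>)) * V \<omega>"
        by (rule Lim_transform_eventually)
      also have "of_bool (\<epsilon> 0 \<omega> = 1 \<and> \<epsilon> h \<omega> = j) * exp (\<i> * of_real (\<theta> * S \<omega>)) * V \<omega>
         = of_bool (\<epsilon> 0 \<omega> = 1 \<and> \<epsilon> h \<omega> = j) * exp (\<i> * of_real (\<theta> * (S \<omega> + \<sigma> * W h \<omega>)))"
        by (simp add: V_def exp_add[symmetric] algebra_simps)
      finally show "(\<lambda>n. U n \<omega> * V \<omega>) \<longlonglongrightarrow> of_bool (\<epsilon> 0 \<omega> = 1 \<and> \<epsilon> h \<omega> = j) * exp (\<i> * of_real (\<theta> * (S \<omega> + \<sigma> * W h \<omega>)))" .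
    qed
  qed auto
  ultimately show ?thesis
    unfolding S_def using LIMSEQ_unique by blast
qed

end
end

section \<open>From transforms to densities\<close>

text \<open>
  By Levy's uniqueness theorem. That \<open>g\<close> integrates to \<open>1\<close> is the hypothesis at \<open>\<theta> = 0\<close>.
\<close>

lemma (in prob_space) has_conditional_densityI_char:
  fixes g :: "real \<Rightarrow> real"
  assumes P [measurable]: "Measurable.pred M P" and pos: "\<P>(\<omega> in M. P \<omega>) > 0"
    and Z [measurable]: "Z \<in> borel_measurable M"
    and g: "\<And>z. 0 \<le> g z" and int: "integrable lborel g"
    and char: "\<And>\<theta>. (\<integral>\<omega>. of_bool (P \<omega>) * exp (\<i> * of_real (\<theta> * Z \<omega>)) \<partial>M)
      = of_real (\<P>(\<omega> in M. P \<omega>)) * (\<integral>z. g z *\<^sub>R exp (\<i> * of_real (\<theta> * z)) \<partial>lborel)"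
  shows "has_conditional_density M P Z g"
proof -
  define A where "A = {\<omega> \<in> space M. P \<omega>}"
  have A [measurable]: "A \<in> events" unfolding A_def by measurable
  have gm [measurable]: "g \<in> borel_measurable borel"
    using borel_measurable_integrable[OF int] by simp
  define N where "N = uniform_measure M A"
  have inv: "1 / ennreal (prob A) = ennreal (1 / prob A)"
    using divide_ennreal[of 1 "prob A"] pos by (simp add: A_def)
  have N_eq: "N = density M (\<lambda>\<omega>. ennreal (indicator A \<omega> / prob A))"
    unfolding N_def uniform_measure_def using pos
    by (intro density_cong) (auto simp: A_def[symmetric] emeasure_eq_measure indicator_def inv)
  interpret N: prob_space N
    unfolding N_def using pos
    by (intro prob_space_uniform_measure) (auto simp: A_def[symmetric] emeasure_eq_measure)
  have ZN [measurable]: "Z \<in> borel_measurable N" by (simp add: N_def)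
  have char_N: "(\<integral>\<omega>. exp (\<i> * of_real (\<theta> * Z \<omega>)) \<partial>N) = (\<integral>z. g z *\<^sub>R exp (\<i> * of_real (\<theta> * z)) \<partial>lborel)" for \<theta>
  proof -
    have "(\<integral>\<omega>. exp (\<i> * of_real (\<theta> * Z \<omega>)) \<partial>N) = (\<integral>\<omega>. (indicator A \<omega> / prob A) *\<^sub>R exp (\<i> * of_real (\<theta> * Z \<omega>)) \<partial>M)"
      unfolding N_eq by (rule integral_density) auto
    also have "\<dots> = (\<integral>\<omega>. (of_bool (P \<omega>) * exp (\<i> * of_real (\<theta> * Z \<omega>))) / of_real (prob A) \<partial>M)"
      by (intro Bochner_Integration.integral_cong) (auto simp: A_def indicator_def scaleR_conv_of_real)
    also have "\<dots> = (\<integral>\<omega>. of_bool (P \<omega>) * exp (\<i> * of_real (\<theta> * Z \<omega>)) \<partial>M) / of_real (prob A)"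
      by (rule integral_divide_zero)
    also have "\<dots> = (\<integral>z. g z *\<^sub>R exp (\<i> * of_real (\<theta> * z)) \<partial>lborel)"
      unfolding char using pos by (simp add: A_def)
    finally show ?thesis .
  qed
  have "of_real (\<integral>z. g z \<partial>lborel) = (\<integral>z. g z *\<^sub>R exp (\<i> * of_real (0 * z)) \<partial>lborel)"
    by (simp add: scaleR_conv_of_real)
  also have "\<dots> = 1"
    unfolding char_N[symmetric] by (simp add: N.prob_space)
  finally have "(\<integral>z. g z \<partial>lborel) = 1" by (metis of_real_eq_1_iff)
  then have "emeasure (density lborel g) (space (density lborel g)) = 1"
    using g int by (simp add: emeasure_density nn_integral_eq_integral)
  then have "prob_space (density lborel g)" by (rule prob_spaceI)
  then have D: "real_distribution (density lborel g)"
    by (simp add: real_distribution_def real_distribution_axioms_def)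
  have "distr N borel Z = density lborel g"
  proof (rule Levy_uniqueness[OF N.real_distribution_distr D])
    show "char (distr N borel Z) = char (density lborel g)"
    proof
      fix \<theta>
      have "char (distr N borel Z) \<theta> = (\<integral>\<omega>. exp (\<i> * of_real (\<theta> * Z \<omega>)) \<partial>N)"
        unfolding char_def by (rule integral_distr) auto
      moreover have "char (density lborel g) \<theta> = (\<integral>z. g z *\<^sub>R exp (\<i> * of_real (\<theta> * z)) \<partial>lborel)"
        unfolding char_def using g by (intro integral_density) auto
      ultimately show "char (distr N borel Z) \<theta> = char (density lborel g) \<theta>"
        by (simp only: char_N)
    qed
  qed simp
  moreover have "distr N lborel Z = distr N borel Z"
    by (intro distr_cong) auto
  ultimately show ?thesis
    using g unfolding has_conditional_density_def distributed_def A_def[symmetric] N_def[symmetric] by simp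
qed

lemma integrable_mult_normal_density:
  fixes K y :: "real \<Rightarrow> real" and s :: real
  assumes K: "integrable lborel K" and y [measurable]: "y \<in> borel_measurable borel"
  shows "integrable lborel (\<lambda>u. K u * normal_density (y u) s z)"
proof (rule Bochner_Integration.integrable_bound[OF integrable_mult_left[OF K, of "1 / sqrt (2 * pi * s\<^sup>2)"]])
  have [measurable]: "K \<in> borel_measurable borel"
    using borel_measurable_integrable[OF K] by simp
  show "(\<lambda>u. K u * normal_density (y u) s z) \<in> borel_measurable lborel"
    unfolding normal_density_def by measurable
  have "norm (normal_density (y u) s z) \<le> norm (1 / sqrt (2 * pi * s\<^sup>2))" for u
  proof -
    have "normal_density (y u) s z \<le> 1 / sqrt (2 * pi * s\<^sup>2) * 1"
      unfolding normal_density_def by (intro mult_left_mono) auto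
    then show ?thesis
      using normal_density_nonneg[of "y u" s z] by simp
  qed
  then show "AE u in lborel. norm (K u * normal_density (y u) s z) \<le> norm (K u * (1 / sqrt (2 * pi * s\<^sup>2)))"
    unfolding norm_mult by (intro always_eventually allI mult_left_mono) auto
qed

text \<open>
  The mixture is the convolution of the image of \<open>K\<close> under \<open>y\<close> with a normal density. Fubini's
  theorem in the mixing variable \<open>u\<close> reduces its transform to that of one normal density.
\<close>

lemma gaussian_mixture:
  fixes K y :: "real \<Rightarrow> real" and s :: real
  assumes s: "0 < s" and K: "integrable lborel K" and y [measurable]: "y \<in> borel_measurable borel"
  shows gaussian_mixture_integrable: "integrable lborel (\<lambda>z. LBINT u. K u * normal_density (y u) s z)"
    and gaussian_mixture_char: "(\<integral>z. (LBINT u. K u * normal_density (y u) s z) *\<^sub>R exp (\<i> * of_real (\<theta> * z)) \<partial>lborel)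
      = (\<integral>u. K u *\<^sub>R exp (\<i> * of_real (\<theta> * y u)) \<partial>lborel) * of_real (exp (- (s * \<theta>)\<^sup>2 / 2))"
proof -
  have Km [measurable]: "K \<in> borel_measurable borel"
    using borel_measurable_integrable[OF K] by simp
  have nd: "integrable lborel (\<lambda>z. normal_density (y u) s z)" for u
    using s by simp
  have inner: "integrable lborel (\<lambda>z. (K u * normal_density (y u) s z) *\<^sub>R (c z :: complex))"
    if [measurable]: "c \<in> borel_measurable borel" and "\<And>z. norm (c z) \<le> 1" for u c
  proof (rule Bochner_Integration.integrable_bound[OF integrable_mult_right[OF nd[of u], of "K u"]])
    have "norm ((K u * normal_density (y u) s z) *\<^sub>R c z) \<le> norm (K u * normal_density (y u) s z)" for z
      using mult_left_mono[OF that(2)[of z], of "norm (K u * normal_density (y u) s z)"]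
      unfolding norm_scaleR real_norm_def by (simp only: mult_1_right abs_ge_zero)
    then show "AE z in lborel. norm ((K u * normal_density (y u) s z) *\<^sub>R c z) \<le> norm (K u * normal_density (y u) s z)"
      by simp
  qed (simp add: normal_density_def)
  have joint: "integrable (lborel \<Otimes>\<^sub>M lborel) (\<lambda>(u, z). (K u * normal_density (y u) s z) *\<^sub>R (c z :: complex))"
    if c [measurable]: "c \<in> borel_measurable borel" and c1: "\<And>z. norm (c z) = 1" for c
  proof (rule lborel_pair.Fubini_integrable)
    show "(\<lambda>(u, z). (K u * normal_density (y u) s z) *\<^sub>R c z) \<in> borel_measurable (lborel \<Otimes>\<^sub>M lborel)"
      unfolding normal_density_def by measurable
    have "(\<lambda>u. LBINT z. norm ((K u * normal_density (y u) s z) *\<^sub>R c z)) = (\<lambda>u. \<bar>K u\<bar>)"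
    proof
      fix u
      have "(LBINT z. norm ((K u * normal_density (y u) s z) *\<^sub>R c z)) = (LBINT z. \<bar>K u\<bar> * normal_density (y u) s z)"
        by (intro Bochner_Integration.integral_cong) (auto simp: c1 abs_mult normal_density_nonneg)
      also have "\<dots> = \<bar>K u\<bar>" using s by simp
      finally show "(LBINT z. norm ((K u * normal_density (y u) s z) *\<^sub>R c z)) = \<bar>K u\<bar>" .
    qed
    then show "integrable lborel (\<lambda>u. LBINT z. norm (case (u, z) of (u, z) \<Rightarrow> (K u * normal_density (y u) s z) *\<^sub>R c z))"
      using K by simp
    show "AE u in lborel. integrable lborel (\<lambda>z. case (u, z) of (u, z) \<Rightarrow> (K u * normal_density (y u) s z) *\<^sub>R c z)"
      using inner[OF c] c1 by simp
  qed
  have "integrable lborel (\<lambda>z. \<integral>u. (K u * normal_density (y u) s z) *\<^sub>R (1::complex) \<partial>lborel)"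
    using joint[of "\<lambda>_. 1"] by (intro lborel_pair.integrable_snd) auto
  also have "(\<lambda>z. \<integral>u. (K u * normal_density (y u) s z) *\<^sub>R (1::complex) \<partial>lborel)
     = (\<lambda>z. of_real (LBINT u. K u * normal_density (y u) s z))"
    by (simp add: scaleR_conv_of_real flip: of_real_mult)
  finally show "integrable lborel (\<lambda>z. LBINT u. K u * normal_density (y u) s z)"
    using integrable_Re by fastforce
  define c where "c z = exp (\<i> * of_real (\<theta> * z))" for z
  have c [measurable]: "c \<in> borel_measurable borel" unfolding c_def[abs_def] by measurable
  have "(\<integral>z. (LBINT u. K u * normal_density (y u) s z) *\<^sub>R c z \<partial>lborel)
      = (\<integral>z. (\<integral>u. (K u * normal_density (y u) s z) *\<^sub>R c z \<partial>lborel) \<partial>lborel)"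
    by (simp only: integral_scaleR_left[OF integrable_mult_normal_density[OF K y]])
  also have "\<dots> = (\<integral>u. (\<integral>z. (K u * normal_density (y u) s z) *\<^sub>R c z \<partial>lborel) \<partial>lborel)"
    by (intro lborel_pair.Fubini_integral joint c) (simp add: c_def)
  also have "\<dots> = (\<integral>u. (K u *\<^sub>R exp (\<i> * of_real (\<theta> * y u))) * of_real (exp (- (s * \<theta>)\<^sup>2 / 2)) \<partial>lborel)"
  proof (intro Bochner_Integration.integral_cong refl)
    fix u
    have "(\<integral>z. (K u * normal_density (y u) s z) *\<^sub>R c z \<partial>lborel) = K u *\<^sub>R (\<integral>z. normal_density (y u) s z *\<^sub>R c z \<partial>lborel)"
      by (simp only: scaleR_scaleR[symmetric] integral_scaleR_right)
    then show "(\<integral>z. (K u * normal_density (y u) s z) *\<^sub>R c z \<partial>lborel)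
       = (K u *\<^sub>R exp (\<i> * of_real (\<theta> * y u))) * of_real (exp (- (s * \<theta>)\<^sup>2 / 2))"
      unfolding c_def integral_iexp_normal_density[OF s] by simp
  qed
  also have "\<dots> = (\<integral>u. K u *\<^sub>R exp (\<i> * of_real (\<theta> * y u)) \<partial>lborel) * of_real (exp (- (s * \<theta>)\<^sup>2 / 2))"
    by (rule integral_mult_left_zero)
  finally show "(\<integral>z. (LBINT u. K u * normal_density (y u) s z) *\<^sub>R exp (\<i> * of_real (\<theta> * z)) \<partial>lborel)
      = (\<integral>u. K u *\<^sub>R exp (\<i> * of_real (\<theta> * y u)) \<partial>lborel) * of_real (exp (- (s * \<theta>)\<^sup>2 / 2))"
    unfolding c_def .
qed

text \<open>
  A function that agrees with a Borel function off one point is itself Borel. This serves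
  integrands whose formula divides by zero at one point.
\<close>

lemma lborel_integral_cong_except:
  fixes f g :: "real \<Rightarrow> real"
  assumes g [measurable]: "g \<in> borel_measurable borel" and eq: "\<And>x. x \<noteq> c \<Longrightarrow> f x = g x"
  shows "(LBINT x. f x) = (LBINT x. g x)"
proof (rule integral_cong_AE)
  have "f = (\<lambda>x. if x = c then f c else g x)" using eq by auto
  moreover have "(\<lambda>x. if x = c then f c else g x) \<in> borel_measurable lborel"
    by measurable
  ultimately show "f \<in> borel_measurable lborel"
    by metis
  show "AE x in lborel. f x = g x"
    using AE_lborel_singleton[of c] by eventually_elim (rule eq)
qed simp

section \<open>The occupation time density in the Bessel form\<close>

text \<open>
  The densities at \<open>u\<close> of the time spent in state \<open>1\<close> up to \<open>h\<close>, for the chain started in \<open>1\<close>: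
  the first on the event that it jumps and is back in \<open>1\<close> at time \<open>h\<close>, the second on the event
  that it is in \<open>2\<close>. The \<open>k\<close>-th term of the Bessel series belongs to \<open>2 k + 2\<close>, respectively
  \<open>2 k + 1\<close>, jumps.
\<close>

definition return_kernel :: "real \<Rightarrow> real \<Rightarrow> real \<Rightarrow> real \<Rightarrow> real" where
  "return_kernel l1 l2 h u = exp (- l1 * u - l2 * (h - u)) * (l1 * l2 * u * bessel_kernel1 (l1 * l2 * u * (h - u)))"

definition switch_kernel :: "real \<Rightarrow> real \<Rightarrow> real \<Rightarrow> real \<Rightarrow> real" where
  "switch_kernel l1 l2 h u = l1 * exp (- l1 * u - l2 * (h - u)) * bessel_kernel0 (l1 * l2 * u * (h - u))"

text \<open>
  The variable of \<open>q_tilde_plus\<close> is the time spent in \<open>1\<close> minus the time spent in \<open>2\<close>, that is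
  \<open>2 u - h\<close>; the factor \<open>2\<close> is its Jacobian. At \<open>u = h\<close> the identity fails, since the square
  root is then \<open>0\<close> by the convention for division by zero.
\<close>

lemma q_tilde_plus_eq_return_kernel:
  assumes "0 < l1" "0 < l2" "0 \<le> u" "u < h"
  shows "exp (- l1 * h) * (2 * q_tilde_plus l1 l2 h (2 * u - h)) = return_kernel l1 l2 h u"
proof -
  have w: "l1 * l2 * (h\<^sup>2 - (2 * u - h)\<^sup>2) = 4 * (l1 * l2 * u * (h - u))"
    by (simp add: power2_eq_square algebra_simps)
  have nn: "0 \<le> l1 * l2 * u * (h - u)" using assms by simp
  have "sqrt ((h + (2 * u - h)) * l2 / ((h - (2 * u - h)) * l1)) * sqrt (4 * (l1 * l2 * u * (h - u)))
      = sqrt ((2 * u * l2)\<^sup>2)"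
    unfolding real_sqrt_mult[symmetric] using assms
    by (intro arg_cong[of _ _ sqrt]) (simp add: field_simps power2_eq_square)
  then have "sqrt ((h + (2 * u - h)) * l2 / ((h - (2 * u - h)) * l1)) * bessel_B1 (sqrt (4 * (l1 * l2 * u * (h - u))))
      = u * l2 * bessel_kernel1 (l1 * l2 * u * (h - u))"
    using nn assms by (simp add: bessel_B1_sqrt)
  moreover have "exp (- l1 * h) * exp ((l1 - l2) / 2 * (h - (2 * u - h))) = exp (- l1 * u - l2 * (h - u))"
    unfolding exp_add[symmetric] by (simp add: algebra_simps add_divide_distrib diff_divide_distrib)
  ultimately show ?thesis
    unfolding q_tilde_plus_def return_kernel_def w by (simp add: mult_ac)
qed

lemma q_tilde_minus_eq_switch_kernel:
  assumes "0 < l1" "0 < l2" "0 \<le> u" "u \<le> h"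
  shows "exp (- l1 * h) * (2 * q_tilde_minus l1 l2 h (2 * u - h)) = switch_kernel l1 l2 h u / l1"
proof -
  have w: "l1 * l2 * (h\<^sup>2 - (2 * u - h)\<^sup>2) = 4 * (l1 * l2 * u * (h - u))"
    by (simp add: power2_eq_square algebra_simps)
  have nn: "0 \<le> l1 * l2 * u * (h - u)" using assms by simp
  then have B: "bessel_B0 (sqrt (4 * (l1 * l2 * u * (h - u)))) = bessel_kernel0 (l1 * l2 * u * (h - u))"
    by (simp add: bessel_B0_sqrt)
  have e: "exp (- l1 * h) * exp ((l1 - l2) / 2 * (h - (2 * u - h))) = exp (- l1 * u - l2 * (h - u))"
    unfolding exp_add[symmetric] by (simp add: algebra_simps add_divide_distrib diff_divide_distrib)
  have "exp (- l1 * h) * (2 * q_tilde_minus l1 l2 h (2 * u - h))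
      = (exp (- l1 * h) * exp ((l1 - l2) / 2 * (h - (2 * u - h)))) * bessel_kernel0 (l1 * l2 * u * (h - u))"
    unfolding q_tilde_minus_def w B by simp
  then show ?thesis
    unfolding e switch_kernel_def using assms by simp
qed

lemma p_tilde_eq: "p_tilde l1 l2 h x = q_tilde_plus l1 l2 h x + l1 * q_tilde_minus l1 l2 h x"
  by (simp add: p_tilde_def q_tilde_plus_def q_tilde_minus_def algebra_simps)

text \<open>
  The substitution \<open>x = (a + b) u + (a - b) (h - u)\<close>, the drift accumulated when \<open>u\<close> time units
  are spent in state \<open>1\<close>. The affine change of variables for the whole line takes care of both
  signs of \<open>b\<close>.
\<close>

lemma occupation_time_substitution:
  fixes k q :: "real \<Rightarrow> real"
  assumes h: "0 < h" and b: "b \<noteq> 0"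
    and k: "k \<in> borel_measurable borel"
    and eq: "\<And>u. 0 \<le> u \<Longrightarrow> u < h \<Longrightarrow> C * (2 * q (2 * u - h)) = k u"
  shows "C * (1 / \<bar>b\<bar> * (LBINT x:{h * (a - \<bar>b\<bar>)..h * (a + \<bar>b\<bar>)}.
      normal_density 0 s (z - x) * q ((x - a * h) / b)))
    = (LBINT u. indicator {0..h} u * k u * normal_density ((a + b) * u + (a - b) * (h - u)) s z)"
proof -
  let ?f = "\<lambda>x. indicator {h * (a - \<bar>b\<bar>)..h * (a + \<bar>b\<bar>)} x *\<^sub>R (normal_density 0 s (z - x) * q ((x - a * h) / b))"
  have "C * (1 / \<bar>b\<bar> * (LBINT x. ?f x)) = C * (1 / \<bar>b\<bar> * (\<bar>2 * b\<bar> *\<^sub>R (LBINT u. ?f ((a - b) * h + 2 * b * u))))"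
    using b by (subst lborel_integral_real_affine[of "2 * b" _ "(a - b) * h"]) auto
  also have "\<dots> = (LBINT u. C * (2 * ?f ((a - b) * h + 2 * b * u)))"
    using b by (simp add: abs_mult)
  also have "\<dots> = (LBINT u. indicator {0..h} u * k u * normal_density ((a + b) * u + (a - b) * (h - u)) s z)"
  proof (rule lborel_integral_cong_except[where c = h])
    show "(\<lambda>u. indicator {0..h} u * k u * normal_density ((a + b) * u + (a - b) * (h - u)) s z) \<in> borel_measurable borel"
      using k unfolding normal_density_def by measurable
    fix u assume "u \<noteq> h"
    define x where "x = (a - b) * h + 2 * b * u"
    have x: "(a + b) * u + (a - b) * (h - u) = x" "(x - a * h) / b = 2 * u - h"
      using b by (auto simp: x_def field_simps)
    have "x \<in> {h * (a - \<bar>b\<bar>)..h * (a + \<bar>b\<bar>)} \<longleftrightarrow> \<bar>b * (2 * u - h)\<bar> \<le> \<bar>b\<bar> * h"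
      by (auto simp: x_def abs_le_iff algebra_simps)
    also have "\<dots> \<longleftrightarrow> \<bar>2 * u - h\<bar> \<le> h"
      using b by (simp add: abs_mult)
    also have "\<dots> \<longleftrightarrow> u \<in> {0..h}" by auto
    finally have "indicator {h * (a - \<bar>b\<bar>)..h * (a + \<bar>b\<bar>)} x = (indicator {0..h} u :: real)"
      by (simp add: indicator_def)
    moreover have "normal_density 0 s (z - x) = normal_density x s z"
      by (simp add: normal_density_def)
    ultimately show "C * (2 * ?f ((a - b) * h + 2 * b * u))
        = indicator {0..h} u * k u * normal_density ((a + b) * u + (a - b) * (h - u)) s z"
      using eq[of u] \<open>u \<noteq> h\<close> unfolding x_def[symmetric] x by (auto simp: indicator_def)
  qed
  finally show ?thesis by (simp add: set_lebesgue_integral_def)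
qed

lemma continuous_on_return_kernel: "continuous_on X (return_kernel l1 l2 h)"
  unfolding return_kernel_def[abs_def] by (intro continuous_intros)

lemma continuous_on_switch_kernel: "continuous_on X (switch_kernel l1 l2 h)"
  unfolding switch_kernel_def[abs_def] by (intro continuous_intros)

lemma exp_drift_phase:
  fixes l1 l2 \<theta> a1 a2 h u :: real
  defines "m1 \<equiv> of_real l1 - \<i> * of_real (\<theta> * a1)" and "m2 \<equiv> of_real l2 - \<i> * of_real (\<theta> * a2)"
  shows "exp (- m2 * of_real h) * exp ((m2 - m1) * of_real u)
     = of_real (exp (- l1 * u - l2 * (h - u))) * exp (\<i> * of_real (\<theta> * (a1 * u + a2 * (h - u))))"
  unfolding exp_of_real[symmetric] exp_add[symmetric]
  by (rule arg_cong[of _ _ exp]) (simp add: m1_def m2_def algebra_simps)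

text \<open>
  Here the solution of the Kolmogorov equation is recognised as the transform of the explicit
  law of the drift: an atom at \<open>a1 * h\<close> from the chain that never jumps, and a part with a
  density.
\<close>

lemma return_char_eq_fourier:
  fixes l1 l2 \<theta> a1 a2 h :: real
  defines "m1 \<equiv> of_real l1 - \<i> * of_real (\<theta> * a1)" and "m2 \<equiv> of_real l2 - \<i> * of_real (\<theta> * a2)"
  shows "return_char l1 l2 m1 m2 h = of_real (exp (- l1 * h)) * exp (\<i> * of_real (\<theta> * (a1 * h)))
    + (\<integral>u. (indicator {0..h} u * return_kernel l1 l2 h u) *\<^sub>R exp (\<i> * of_real (\<theta> * (a1 * u + a2 * (h - u)))) \<partial>lborel)"
proof -
  let ?f = "\<lambda>u. return_kernel l1 l2 h u *\<^sub>R exp (\<i> * of_real (\<theta> * (a1 * u + a2 * (h - u))))"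
  have "exp (- m2 * of_real h) * bessel_int1 (l1 * l2) (m2 - m1) h = integral {0..h} ?f"
    unfolding bessel_int1_def integral_mult_right[symmetric]
  proof (rule integral_cong)
    fix u
    show "exp (- m2 * of_real h) * (exp ((m2 - m1) * of_real u) * of_real (l1 * l2 * u * bessel_kernel1 (l1 * l2 * u * (h - u)))) = ?f u"
      unfolding mult.assoc[symmetric] m1_def m2_def exp_drift_phase
      by (simp add: return_kernel_def scaleR_conv_of_real)
  qed
  also have "\<dots> = (LINT u:{0..h}|lborel. ?f u)"
    by (intro set_borel_integral_eq_integral(2)[symmetric] borel_integrable_atLeastAtMost')
       (intro continuous_intros continuous_on_return_kernel)
  also have "\<dots> = (\<integral>u. (indicator {0..h} u * return_kernel l1 l2 h u) *\<^sub>R exp (\<i> * of_real (\<theta> * (a1 * u + a2 * (h - u)))) \<partial>lborel)"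
    by (simp only: set_lebesgue_integral_def scaleR_scaleR)
  moreover have "exp (- m1 * of_real h) = of_real (exp (- l1 * h)) * exp (\<i> * of_real (\<theta> * (a1 * h)))"
    unfolding exp_of_real[symmetric] exp_add[symmetric]
    by (rule arg_cong[of _ _ exp]) (simp add: m1_def algebra_simps)
  ultimately show ?thesis by (simp only: return_char_def)
qed

lemma switch_char_eq_fourier:
  fixes l1 l2 \<theta> a1 a2 h :: real
  defines "m1 \<equiv> of_real l1 - \<i> * of_real (\<theta> * a1)" and "m2 \<equiv> of_real l2 - \<i> * of_real (\<theta> * a2)"
  shows "switch_char l1 l2 m1 m2 h
    = (\<integral>u. (indicator {0..h} u * switch_kernel l1 l2 h u) *\<^sub>R exp (\<i> * of_real (\<theta> * (a1 * u + a2 * (h - u)))) \<partial>lborel)"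
proof -
  let ?f = "\<lambda>u. switch_kernel l1 l2 h u *\<^sub>R exp (\<i> * of_real (\<theta> * (a1 * u + a2 * (h - u))))"
  have "switch_char l1 l2 m1 m2 h = integral {0..h} ?f"
    unfolding switch_char_def bessel_int0_def integral_mult_right[symmetric]
  proof (rule integral_cong)
    fix u
    have "of_real l1 * (exp (- m2 * of_real h) * (exp ((m2 - m1) * of_real u) * of_real (bessel_kernel0 (l1 * l2 * u * (h - u)))))
        = of_real l1 * ((exp (- m2 * of_real h) * exp ((m2 - m1) * of_real u)) * of_real (bessel_kernel0 (l1 * l2 * u * (h - u))))"
      by (simp only: mult.assoc)
    then show "of_real l1 * (exp (- m2 * of_real h) * (exp ((m2 - m1) * of_real u) * of_real (bessel_kernel0 (l1 * l2 * u * (h - u))))) = ?f u"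
      unfolding m1_def m2_def exp_drift_phase by (simp add: switch_kernel_def scaleR_conv_of_real)
  qed
  also have "\<dots> = (LINT u:{0..h}|lborel. ?f u)"
    by (intro set_borel_integral_eq_integral(2)[symmetric] borel_integrable_atLeastAtMost')
       (intro continuous_intros continuous_on_switch_kernel)
  finally show ?thesis
    by (simp only: set_lebesgue_integral_def scaleR_scaleR)
qed

section \<open>The conditional densities\<close>

theorem theorem3p2:
  fixes M :: "'w measure"
    and \<epsilon> :: "real \<Rightarrow> 'w \<Rightarrow> 2"
    and W :: "real \<Rightarrow> 'w \<Rightarrow> real"
    and Z :: "'w \<Rightarrow> real"
    and \<alpha> :: "2 \<Rightarrow> real"
    and l1 l2 \<sigma> h a b1 :: real
  assumes "prob_space M"
    and "l1 > 0" and "l2 > 0" and "\<sigma> > 0" and "h > 0"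
    and "\<alpha> 1 \<noteq> \<alpha> 2"
    and "prob_space.markov_chain M (intensity_matrix l1 l2) \<epsilon>"
    and "prob_space.standard_brownian_motion M W"
    and "prob_space.indep_processes M (count_space UNIV) \<epsilon> borel W"
    and "\<P>(\<omega> in M. \<epsilon> 0 \<omega> = 1) > 0"
    and "Z = (\<lambda>\<omega>. (LBINT s:{0..h}. \<alpha> (\<epsilon> s \<omega>)) + \<sigma> * W h \<omega>)"
    and "a = 1 / 2 * (\<alpha> 1 + \<alpha> 2)"
    and "b1 = 1 / 2 * (\<alpha> 1 - \<alpha> 2)"
  shows "has_conditional_density M (\<lambda>\<omega>. \<epsilon> 0 \<omega> = 1) Z
           (\<lambda>z. exp (- l1 * h) *
              (normal_density 0 (\<sigma> * sqrt h) (z - h * (b1 + a)) +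
               1 / \<bar>b1\<bar> * (LBINT x:{h * (a - \<bar>b1\<bar>)..h * (a + \<bar>b1\<bar>)}.
                 normal_density 0 (\<sigma> * sqrt h) (z - x) * p_tilde l1 l2 h ((x - a * h) / b1)))) \<and>
         has_conditional_density M (\<lambda>\<omega>. \<epsilon> 0 \<omega> = 1 \<and> \<epsilon> h \<omega> = 1) Z
           (\<lambda>z. (l1 + l2) / (l2 * exp (l1 * h) + l1 * exp (- l2 * h)) *
              (normal_density 0 (\<sigma> * sqrt h) (z - h * (b1 + a)) +
               1 / \<bar>b1\<bar> * (LBINT x:{h * (a - \<bar>b1\<bar>)..h * (a + \<bar>b1\<bar>)}.
                 normal_density 0 (\<sigma> * sqrt h) (z - x) * q_tilde_plus l1 l2 h ((x - a * h) / b1)))) \<and>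
         has_conditional_density M (\<lambda>\<omega>. \<epsilon> 0 \<omega> = 1 \<and> \<epsilon> h \<omega> = 2) Z
           (\<lambda>z. (l1 + l2) / (exp (l1 * h) - exp (- l2 * h)) * (1 / \<bar>b1\<bar>) *
              (LBINT x:{h * (a - \<bar>b1\<bar>)..h * (a + \<bar>b1\<bar>)}.
                 normal_density 0 (\<sigma> * sqrt h) (z - x) * q_tilde_minus l1 l2 h ((x - a * h) / b1)))"
proof -
  interpret prob_space M by fact
  note l = \<open>l1 > 0\<close> \<open>l2 > 0\<close> and h = \<open>h > 0\<close>
  note mc = \<open>markov_chain (intensity_matrix l1 l2) \<epsilon>\<close>
  note bm = \<open>standard_brownian_motion W\<close>
  note ind = \<open>indep_processes (count_space UNIV) \<epsilon> borel W\<close>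
  note Z = \<open>Z = (\<lambda>\<omega>. (LBINT s:{0..h}. \<alpha> (\<epsilon> s \<omega>)) + \<sigma> * W h \<omega>)\<close>
  define s where "s = \<sigma> * sqrt h"
  have s: "0 < s" using \<open>\<sigma> > 0\<close> h by (simp add: s_def)
  have b: "b1 \<noteq> 0" and \<alpha>1: "\<alpha> 1 = a + b1" and \<alpha>2: "\<alpha> 2 = a - b1"
    using assms(6,12,13) by (auto simp: field_simps)
  define y where "y u = (a + b1) * u + (a - b1) * (h - u)" for u
  have y [measurable]: "y \<in> borel_measurable borel" unfolding y_def[abs_def] by measurable
  define K1 where "K1 u = indicator {0..h} u * return_kernel l1 l2 h u" for u
  define K2 where "K2 u = indicator {0..h} u * switch_kernel l1 l2 h u" for u
  \<comment> \<open>For \<open>j = 1, 2\<close>, the density of \<open>Z\<close> given \<open>\<epsilon>\<^sub>0 = 1\<close> and \<open>\<epsilon>\<^sub>h = j\<close>, times the probability of \<open>\<epsilon>\<^sub>h = j\<close> given \<open>\<epsilon>\<^sub>0 = 1\<close>.\<close>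
  define G1 where "G1 z = exp (- l1 * h) * normal_density (h * (b1 + a)) s z
      + (LBINT u. K1 u * normal_density (y u) s z)" for z
  define G2 where "G2 z = (LBINT u. K2 u * normal_density (y u) s z)" for z
  define p where "p = \<P>(\<omega> in M. \<epsilon> 0 \<omega> = 1)"
  define e where "e \<theta> z = exp (\<i> * of_real (\<theta> * z))" for \<theta> z :: real
  have [measurable]: "return_kernel l1 l2 h \<in> borel_measurable borel" "switch_kernel l1 l2 h \<in> borel_measurable borel"
    by (intro borel_measurable_continuous_onI continuous_on_return_kernel continuous_on_switch_kernel)+
  have int_K: "integrable lborel K1" "integrable lborel K2"
    using borel_integrable_atLeastAtMost'[OF continuous_on_return_kernel, of 0 h l1 l2 h]
      borel_integrable_atLeastAtMost'[OF continuous_on_switch_kernel, of 0 h l1 l2 h]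
    by (simp_all add: set_integrable_def K1_def[abs_def] K2_def[abs_def])
  have K_nonneg: "0 \<le> K1 u" "0 \<le> K2 u" for u
    using l by (auto simp: K1_def K2_def return_kernel_def switch_kernel_def indicator_def bessel_kernel_nonneg)
  have G_nonneg: "0 \<le> G1 z" "0 \<le> G2 z" for z
    using K_nonneg unfolding G1_def G2_def
    by (auto intro!: add_nonneg_nonneg integral_nonneg_AE mult_nonneg_nonneg normal_density_nonneg)
  have int_G: "integrable lborel G1" "integrable lborel G2"
    unfolding G1_def[abs_def] G2_def[abs_def] using s
    by (auto intro!: Bochner_Integration.integrable_add integrable_mult_right gaussian_mixture_integrable int_K y)
  have int_Ge: "integrable lborel (\<lambda>z. g z *\<^sub>R e \<theta> z)" if "integrable lborel g" for g :: "real \<Rightarrow> real" and \<theta>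
  proof (rule Bochner_Integration.integrable_bound[OF that])
    have [measurable]: "g \<in> borel_measurable borel"
      using borel_measurable_integrable[OF that] by simp
    show "(\<lambda>z. g z *\<^sub>R e \<theta> z) \<in> borel_measurable lborel"
      unfolding e_def by measurable
  qed (simp add: e_def)
  define m1 m2 where "m1 \<theta> = of_real l1 - \<i> * of_real (\<theta> * \<alpha> 1)" and "m2 \<theta> = of_real l2 - \<i> * of_real (\<theta> * \<alpha> 2)" for \<theta> :: real
  have G1_char: "(\<integral>z. G1 z *\<^sub>R e \<theta> z \<partial>lborel) = return_char l1 l2 (m1 \<theta>) (m2 \<theta>) h * of_real (exp (- (s * \<theta>)\<^sup>2 / 2))" for \<theta>
  proof -
    have "(\<integral>z. G1 z *\<^sub>R e \<theta> z \<partial>lborel)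
       = (\<integral>z. exp (- l1 * h) *\<^sub>R (normal_density (h * (b1 + a)) s z *\<^sub>R e \<theta> z)
           + (LBINT u. K1 u * normal_density (y u) s z) *\<^sub>R e \<theta> z \<partial>lborel)"
      unfolding G1_def by (simp only: scaleR_add_left scaleR_scaleR)
    also have "\<dots> = (\<integral>z. exp (- l1 * h) *\<^sub>R (normal_density (h * (b1 + a)) s z *\<^sub>R e \<theta> z) \<partial>lborel)
        + (\<integral>z. (LBINT u. K1 u * normal_density (y u) s z) *\<^sub>R e \<theta> z \<partial>lborel)"
      by (intro Bochner_Integration.integral_add integrable_scaleR_right int_Ge gaussian_mixture_integrable int_K s y)
         (use s in simp)
    also have "(\<integral>z. exp (- l1 * h) *\<^sub>R (normal_density (h * (b1 + a)) s z *\<^sub>R e \<theta> z) \<partial>lborel)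
        = exp (- l1 * h) *\<^sub>R (exp (\<i> * of_real (\<theta> * (h * (b1 + a)))) * of_real (exp (- (s * \<theta>)\<^sup>2 / 2)))"
      unfolding integral_scaleR_right e_def integral_iexp_normal_density[OF s] ..
    also have "(\<integral>z. (LBINT u. K1 u * normal_density (y u) s z) *\<^sub>R e \<theta> z \<partial>lborel)
       = (\<integral>u. K1 u *\<^sub>R e \<theta> (y u) \<partial>lborel) * of_real (exp (- (s * \<theta>)\<^sup>2 / 2))"
      unfolding e_def by (rule gaussian_mixture_char[OF s int_K(1) y])
    finally show ?thesis
      unfolding m1_def m2_def return_char_eq_fourier
      by (simp add: \<alpha>1 \<alpha>2 K1_def y_def e_def scaleR_conv_of_real algebra_simps)
  qed
  have G2_char: "(\<integral>z. G2 z *\<^sub>R e \<theta> z \<partial>lborel) = switch_char l1 l2 (m1 \<theta>) (m2 \<theta>) h * of_real (exp (- (s * \<theta>)\<^sup>2 / 2))" for \<theta>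
    unfolding m1_def m2_def switch_char_eq_fourier G2_def e_def gaussian_mixture_char[OF s int_K(2) y]
    by (simp only: \<alpha>1 \<alpha>2 K2_def y_def)
  have [measurable]: "\<epsilon> 0 \<in> measurable M (count_space UNIV)" "\<epsilon> h \<in> measurable M (count_space UNIV)"
    using markov_chain_measurable[OF mc] h by auto
  have [measurable]: "W h \<in> borel_measurable M"
    using bm h by (simp add: standard_brownian_motion_def)
  have Zm [measurable]: "Z \<in> borel_measurable M"
    unfolding Z using drift_borel[OF l h mc bm ind, of \<alpha>] by measurable
  have Z_char: "(\<integral>\<omega>. of_bool (\<epsilon> 0 \<omega> = 1 \<and> \<epsilon> h \<omega> = 1) * e \<theta> (Z \<omega>) \<partial>M) = of_real p * (\<integral>z. G1 z *\<^sub>R e \<theta> z \<partial>lborel)"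
    "(\<integral>\<omega>. of_bool (\<epsilon> 0 \<omega> = 1 \<and> \<epsilon> h \<omega> = 2) * e \<theta> (Z \<omega>) \<partial>M) = of_real p * (\<integral>z. G2 z *\<^sub>R e \<theta> z \<partial>lborel)" for \<theta>
    unfolding G1_char G2_char unfolding e_def Z m1_def m2_def p_def s_def
    using char_drift_plus_noise[OF l h mc bm ind matrix_steps_two_state_tendsto(1)[OF l h, of \<theta> \<alpha>], of \<sigma>]
      char_drift_plus_noise[OF l h mc bm ind matrix_steps_two_state_tendsto(2)[OF l h, of \<theta> \<alpha>], of \<sigma>]
    by (simp_all only: mult.assoc)
  define E where "E = exp (- (l1 + l2) * h)"
  have E: "0 < E" "E < 1" using mult_pos_pos[OF add_pos_pos[OF l] h] by (auto simp: E_def algebra_simps)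
  \<comment> \<open>The entries \<open>(1, 1)\<close> and \<open>(1, 2)\<close> of the transition matrix over the time \<open>h\<close>.\<close>
  define q1 where "q1 = (l2 + l1 * E) / (l1 + l2)"
  define q2 where "q2 = l1 * (1 - E) / (l1 + l2)"
  have q: "0 < q1" "0 < q2" using l E by (auto simp: q1_def q2_def add_pos_pos)
  have prob_1j: "\<P>(\<omega> in M. \<epsilon> 0 \<omega> = 1 \<and> \<epsilon> h \<omega> = j) = matrix_exp (h *\<^sub>R intensity_matrix l1 l2) $ 1 $ j * p" for j
    using markov_chain_step[OF mc, of 0 h 0 _ j 1] h by (simp add: p_def conj_commute)
  have prob_11: "\<P>(\<omega> in M. \<epsilon> 0 \<omega> = 1 \<and> \<epsilon> h \<omega> = 1) = q1 * p" and prob_12: "\<P>(\<omega> in M. \<epsilon> 0 \<omega> = 1 \<and> \<epsilon> h \<omega> = 2) = q2 * p"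
    unfolding prob_1j matrix_exp_intensity_matrix[OF l] E_def[symmetric] using l
    by (simp_all add: mat_def q1_def q2_def field_simps)
  have p: "0 < p" using \<open>\<P>(\<omega> in M. \<epsilon> 0 \<omega> = 1) > 0\<close> by (simp add: p_def)
  have scaled: "(\<integral>z. (g z / q) *\<^sub>R e \<theta> z \<partial>lborel) = (\<integral>z. g z *\<^sub>R e \<theta> z \<partial>lborel) / of_real q" for g q \<theta>
  proof -
    have "(\<lambda>z. (g z / q) *\<^sub>R e \<theta> z) = (\<lambda>z. (g z *\<^sub>R e \<theta> z) / of_real q)"
      by (auto simp: scaleR_conv_of_real)
    then show ?thesis by (simp only: integral_divide_zero)
  qed
  have D11: "has_conditional_density M (\<lambda>\<omega>. \<epsilon> 0 \<omega> = 1 \<and> \<epsilon> h \<omega> = 1) Z (\<lambda>z. G1 z / q1)"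
  proof (rule has_conditional_densityI_char)
    show "(\<integral>\<omega>. of_bool (\<epsilon> 0 \<omega> = 1 \<and> \<epsilon> h \<omega> = 1) * exp (\<i> * of_real (\<theta> * Z \<omega>)) \<partial>M)
      = of_real (\<P>(\<omega> in M. \<epsilon> 0 \<omega> = 1 \<and> \<epsilon> h \<omega> = 1)) * (\<integral>z. (G1 z / q1) *\<^sub>R exp (\<i> * of_real (\<theta> * z)) \<partial>lborel)" for \<theta>
      unfolding e_def[symmetric] scaled Z_char prob_11 using q by simp
  qed (use q p G_nonneg int_G prob_11 in \<open>simp_all\<close>)
  have D12: "has_conditional_density M (\<lambda>\<omega>. \<epsilon> 0 \<omega> = 1 \<and> \<epsilon> h \<omega> = 2) Z (\<lambda>z. G2 z / q2)"
  proof (rule has_conditional_densityI_char)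
    show "(\<integral>\<omega>. of_bool (\<epsilon> 0 \<omega> = 1 \<and> \<epsilon> h \<omega> = 2) * exp (\<i> * of_real (\<theta> * Z \<omega>)) \<partial>M)
      = of_real (\<P>(\<omega> in M. \<epsilon> 0 \<omega> = 1 \<and> \<epsilon> h \<omega> = 2)) * (\<integral>z. (G2 z / q2) *\<^sub>R exp (\<i> * of_real (\<theta> * z)) \<partial>lborel)" for \<theta>
      unfolding e_def[symmetric] scaled Z_char prob_12 using q by simp
  qed (use q p G_nonneg int_G prob_12 in \<open>simp_all\<close>)
  have D1: "has_conditional_density M (\<lambda>\<omega>. \<epsilon> 0 \<omega> = 1) Z (\<lambda>z. G1 z + G2 z)"
  proof (rule has_conditional_densityI_char)
    fix \<theta>
    have int: "integrable M (\<lambda>\<omega>. of_bool (\<epsilon> 0 \<omega> = 1 \<and> \<epsilon> h \<omega> = j) * e \<theta> (Z \<omega>))" for j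
      by (rule integrable_const_bound[where B = 1]) (auto simp: e_def norm_mult)
    have "(\<integral>\<omega>. of_bool (\<epsilon> 0 \<omega> = 1) * e \<theta> (Z \<omega>) \<partial>M)
       = (\<integral>\<omega>. of_bool (\<epsilon> 0 \<omega> = 1 \<and> \<epsilon> h \<omega> = 1) * e \<theta> (Z \<omega>) + of_bool (\<epsilon> 0 \<omega> = 1 \<and> \<epsilon> h \<omega> = 2) * e \<theta> (Z \<omega>) \<partial>M)"
    proof (intro Bochner_Integration.integral_cong refl)
      fix \<omega>
      show "of_bool (\<epsilon> 0 \<omega> = 1) * e \<theta> (Z \<omega>)
        = of_bool (\<epsilon> 0 \<omega> = 1 \<and> \<epsilon> h \<omega> = 1) * e \<theta> (Z \<omega>) + of_bool (\<epsilon> 0 \<omega> = 1 \<and> \<epsilon> h \<omega> = 2) * e \<theta> (Z \<omega>)"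
        using exhaust_2[of "\<epsilon> h \<omega>"] by auto
    qed
    also have "\<dots> = of_real p * (\<integral>z. G1 z *\<^sub>R e \<theta> z \<partial>lborel) + of_real p * (\<integral>z. G2 z *\<^sub>R e \<theta> z \<partial>lborel)"
      using int by (simp only: Bochner_Integration.integral_add Z_char)
    also have "\<dots> = of_real p * (\<integral>z. (G1 z + G2 z) *\<^sub>R e \<theta> z \<partial>lborel)"
      using int_Ge[OF int_G(1)] int_Ge[OF int_G(2)]
      by (simp only: scaleR_add_left Bochner_Integration.integral_add distrib_left)
    finally show "(\<integral>\<omega>. of_bool (\<epsilon> 0 \<omega> = 1) * exp (\<i> * of_real (\<theta> * Z \<omega>)) \<partial>M)
      = of_real (\<P>(\<omega> in M. \<epsilon> 0 \<omega> = 1)) * (\<integral>z. (G1 z + G2 z) *\<^sub>R exp (\<i> * of_real (\<theta> * z)) \<partial>lborel)"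
      by (simp only: e_def p_def)
  qed (use p G_nonneg int_G in \<open>simp_all add: p_def\<close>)
  have nd: "normal_density 0 s (z - h * (b1 + a)) = normal_density (h * (b1 + a)) s z" for z
    by (simp add: normal_density_def)
  have plus: "exp (- l1 * h) * (1 / \<bar>b1\<bar> * (LBINT x:{h * (a - \<bar>b1\<bar>)..h * (a + \<bar>b1\<bar>)}.
      normal_density 0 s (z - x) * q_tilde_plus l1 l2 h ((x - a * h) / b1))) = (LBINT u. K1 u * normal_density (y u) s z)" for z
    unfolding K1_def y_def
    by (rule occupation_time_substitution[OF h b]) (use q_tilde_plus_eq_return_kernel[OF l] in simp_all)
  have minus: "l1 * exp (- l1 * h) * (1 / \<bar>b1\<bar> * (LBINT x:{h * (a - \<bar>b1\<bar>)..h * (a + \<bar>b1\<bar>)}.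
      normal_density 0 s (z - x) * q_tilde_minus l1 l2 h ((x - a * h) / b1))) = G2 z" for z
    unfolding K2_def y_def G2_def
  proof (rule occupation_time_substitution[OF h b])
    fix u assume "0 \<le> u" "u < h"
    then show "l1 * exp (- l1 * h) * (2 * q_tilde_minus l1 l2 h (2 * u - h)) = switch_kernel l1 l2 h u"
      using q_tilde_minus_eq_switch_kernel[OF l, of u h] l by (simp add: field_simps)
  qed simp
  have both: "exp (- l1 * h) * (1 / \<bar>b1\<bar> * (LBINT x:{h * (a - \<bar>b1\<bar>)..h * (a + \<bar>b1\<bar>)}.
      normal_density 0 s (z - x) * p_tilde l1 l2 h ((x - a * h) / b1)))
      = (LBINT u. K1 u * normal_density (y u) s z) + G2 z" for z
  proof -
    have "exp (- l1 * h) * (1 / \<bar>b1\<bar> * (LBINT x:{h * (a - \<bar>b1\<bar>)..h * (a + \<bar>b1\<bar>)}.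
        normal_density 0 s (z - x) * p_tilde l1 l2 h ((x - a * h) / b1)))
      = (LBINT u. indicator {0..h} u * (return_kernel l1 l2 h u + switch_kernel l1 l2 h u)
          * normal_density ((a + b1) * u + (a - b1) * (h - u)) s z)"
    proof (rule occupation_time_substitution[OF h b])
      fix u assume "0 \<le> u" "u < h"
      then show "exp (- l1 * h) * (2 * p_tilde l1 l2 h (2 * u - h)) = return_kernel l1 l2 h u + switch_kernel l1 l2 h u"
        using q_tilde_plus_eq_return_kernel[OF l, of u h] q_tilde_minus_eq_switch_kernel[OF l, of u h] l
        by (simp add: p_tilde_eq field_simps)
    qed simp
    also have "\<dots> = (LBINT u. K1 u * normal_density (y u) s z + K2 u * normal_density (y u) s z)"
      by (simp add: K1_def K2_def y_def algebra_simps)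
    also have "\<dots> = (LBINT u. K1 u * normal_density (y u) s z) + G2 z"
      unfolding G2_def by (intro Bochner_Integration.integral_add integrable_mult_normal_density int_K y)
    finally show ?thesis .
  qed
  have "exp (- l2 * h) = exp (l1 * h) * E"
    by (simp add: E_def exp_add[symmetric] algebra_simps)
  moreover have "exp (- l1 * h) = 1 / exp (l1 * h)"
    by (simp add: exp_minus inverse_eq_divide)
  moreover have "l2 + l1 * E > 0" "1 - E > 0"
    using l E by (auto simp: add_pos_pos)
  moreover have "l2 * x + l1 * (x * E) = x * (l2 + l1 * E)" "x - x * E = x * (1 - E)" for x
    by (simp_all add: algebra_simps)
  ultimately have c1: "(l1 + l2) / (l2 * exp (l1 * h) + l1 * exp (- l2 * h)) = exp (- l1 * h) / q1"
    and c2: "(l1 + l2) / (exp (l1 * h) - exp (- l2 * h)) = l1 * exp (- l1 * h) / q2"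
    using l by (simp_all add: q1_def q2_def)
  show ?thesis
  proof (intro conjI)
    show "has_conditional_density M (\<lambda>\<omega>. \<epsilon> 0 \<omega> = 1) Z
           (\<lambda>z. exp (- l1 * h) *
              (normal_density 0 (\<sigma> * sqrt h) (z - h * (b1 + a)) +
               1 / \<bar>b1\<bar> * (LBINT x:{h * (a - \<bar>b1\<bar>)..h * (a + \<bar>b1\<bar>)}.
                 normal_density 0 (\<sigma> * sqrt h) (z - x) * p_tilde l1 l2 h ((x - a * h) / b1))))"
      unfolding s_def[symmetric] nd distrib_left[of "exp (- l1 * h)"] both using D1 by (simp add: G1_def add.assoc)
    show "has_conditional_density M (\<lambda>\<omega>. \<epsilon> 0 \<omega> = 1 \<and> \<epsilon> h \<omega> = 1) Z
           (\<lambda>z. (l1 + l2) / (l2 * exp (l1 * h) + l1 * exp (- l2 * h)) *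
              (normal_density 0 (\<sigma> * sqrt h) (z - h * (b1 + a)) +
               1 / \<bar>b1\<bar> * (LBINT x:{h * (a - \<bar>b1\<bar>)..h * (a + \<bar>b1\<bar>)}.
                 normal_density 0 (\<sigma> * sqrt h) (z - x) * q_tilde_plus l1 l2 h ((x - a * h) / b1))))"
      unfolding s_def[symmetric] nd c1 times_divide_eq_left[of _ q1] distrib_left[of "exp (- l1 * h)"] plus
      using D11 by (simp only: G1_def)
    show "has_conditional_density M (\<lambda>\<omega>. \<epsilon> 0 \<omega> = 1 \<and> \<epsilon> h \<omega> = 2) Z
           (\<lambda>z. (l1 + l2) / (exp (l1 * h) - exp (- l2 * h)) * (1 / \<bar>b1\<bar>) *
              (LBINT x:{h * (a - \<bar>b1\<bar>)..h * (a + \<bar>b1\<bar>)}.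
                 normal_density 0 (\<sigma> * sqrt h) (z - x) * q_tilde_minus l1 l2 h ((x - a * h) / b1)))"
      unfolding s_def[symmetric] c2 mult.assoc[of _ "1 / \<bar>b1\<bar>"] times_divide_eq_left[of _ q2] minus
      using D12 .
  qed
qed

end
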